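(* Let $\mathcal M,\mathcal N$ be $C^2$-manifolds of dimensions $m,n$, let $\mathcal K\subset\mathcal N$ be a submanifold with corners of dimension $k$, let $f\in C^2(\mathcal M,\mathbb R)$, $g\in C^2(\mathcal M,\mathcal N)$, and $\mathcal F=\{p\in\mathcal M : g(p)\in\mathcal K\}$. Let $p_*\in\mathcal F$. Let $R_{p_*}:V_{0_{p_*}}\to\mathcal M$ be a local retraction at $p_*$ and $S_{g(p_* )}:\mathcal U_{g(p_* )}\to T_{g(p_* )}\mathcal N$ a local linearizing map at $g(p_* )$ adapted to $\mathcal K$, with domains small enough that both are injective and $g(R_{p_*}(V_{0_{p_*}}))\subset\mathcal U_{g(p_* )}$. Define $$\bar f=f\circ R_{p_*},\quad \bar g=S_{g(p_* )}\circ g\circ R_{p_*},\quad \bar K=S_{g(p_* )}(\mathcal K\cap\mathcal U_{g(p_* )})=T^i_{g(p_* )}\mathcal K\cap S_{g(p_* )}(\mathcal U_{g(p_* )}).$$ Then $p_*$ is a local minimizer of $f$ over $\mathcal F$ if and only if $v_*=0_{p_*}\in T_{p_*}\mathcal M$ is a local minimizer of the problem: minimize $\bar f(v)$ over $v\in V_{0_{p_*}}$ subject to $\bar g(v)\in\bar K$. In this case, if $\operatorname{image} g'(p_* )-T^i_{g(p_* )}\mathcal K=T_{g(p_* )}\mathcal N$ (ZKRCQ), then there exists $\mu\in T^*_{g(p_* )}\mathcal N$ such that $$\bar f'(0_{p_*})+\mu\,\bar g'(0_{p_*})=0\ \text{ in }T^*_{p_*}\mathcal M,\qquad \mu\in\bigl(\mathcal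 T_{0_{g(p_* )}}\bar K\bigr)^\circ=\bigl(T^i_{g(p_* )}\mathcal K\bigr)^\circ,$$ where $\mathcal T_{0_{g(p_* )}}\bar K$ is the tangent cone of $\bar K\subset T_{g(p_* )}\mathcal N$ at $0_{g(p_* )}$.
   Context: Manifolds are finite-dimensional and without boundary. A subset $\mathcal K\subset\mathcal N$ is a submanifold with corners of dimension $k$ ($0\le k\le n$) if for each $q\in\mathcal K$ there are a chart $(\mathcal U,\psi)$ of $\mathcal N$ with $q\in\mathcal U$, $\psi(q)=0$, an integer $0\le\ell\le k$, and a surjective linear map $A:\mathbb R^k\times\{0\}^{n-k}\to\mathbb R^\ell$ such that $\psi(\mathcal K\cap\mathcal U)=\{x\in\psi(\mathcal U) : Wx=0,\ Ax\le 0\}$, where $Wx=(x_{k+1},\dots,x_n)^{\mathsf T}$ and $\le$ is componentwise. Such a chart is called an adapted chart centered at $q$; $A$ is identified with the matrix $[\widehat A\ \ 0]\in\mathbb R^{\ell\times n}$. With $v_\psi$ the representative of $v\in T_q\mathcal N$ in an adapted chart $\psi$ centered at $q\in\mathcal K$, $T^i_q\mathcal K=\{v\in T_q\mathcal N : Wv_\psi=0,\ Av_\psi\le0\}$ (independent of the adapted chart). A local retraction at $p\in\mathcal M$ is a $C^2$-map $R_p:V_{0_p}\to\mathcal M$ on an open neighborhood $V_{0_p}\subset T_p\mathcal M$ of the zero vector $0_p$, with $R_p(0_p)=p$ and $DR_p(0_p)=\mathrm{id}_{T_p\mathcal M}$. A local linearizing map at $q\in\mathcal N$ is a $C^2$-map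 $S_q:\mathcal U_q\to T_q\mathcal N$ on an open neighborhood $\mathcal U_q\subset\mathcal N$ of $q$ with $S_q(q)=0_q$ and $DS_q(q)=\mathrm{id}_{T_q\mathcal N}$; it is adapted to $\mathcal K$ if $S_q(\mathcal U_q\cap\mathcal K)=S_q(\mathcal U_q)\cap T^i_q\mathcal K$. The tangent cone at $0$ of a subset $C\ni0$ of a finite-dimensional vector space $X$ is the set of $v\in X$ for which there exist $t_j\searrow0$ ($t_j>0$) and $x_j\to v$ with $t_jx_j\in C$ for all $j$. The polar cone of $S\subset V$ is $S^\circ=\{v^*\in V^*:\langle v^*,s\rangle\le0\ \forall s\in S\}$. $\mu\,\bar g'(0_{p_*})$ denotes composition of linear maps. *)

theory Defs
  imports "HOL-Analysis.Analysis" "HOL-Library.Function_Algebras"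
begin

section \<open>The model space\<close>

text \<open>
  The model spaces are types of sort \<open>{real_inner, heine_borel}\<close>, that is, finite-dimensional
  inner product spaces.  In contrast to \<open>euclidean_space\<close> this includes the
  zero-dimensional space.  Such a type is identified with \<open>\<real>\<^sup>n\<close> by an orthonormal basis
  \<open>e 0, \<dots>, e (n - 1)\<close>; the (0-based) \<open>j\<close>-th coordinate of \<open>x\<close> is \<open>x \<bullet> e j\<close>.
\<close>

definition coordinate_basis :: "nat \<Rightarrow> (nat \<Rightarrow> 'e::real_inner) \<Rightarrow> bool" where
  "coordinate_basis n e \<longleftrightarrow>
     (\<forall>i<n. \<forall>j<n. e i \<bullet> e j = (if i = j then 1 else 0)) \<and>
     (\<forall>x. x = (\<Sum>j<n. (x \<bullet> e j) *\<^sub>R e j))"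

text \<open>Only meant for open \<open>X\<close>: the derivatives are not taken within \<open>X\<close>.\<close>

definition C2_on :: "'a::real_normed_vector set \<Rightarrow> ('a \<Rightarrow> 'b::real_normed_vector) \<Rightarrow> bool" where
  "C2_on X h \<longleftrightarrow>
     (\<exists>(h' :: 'a \<Rightarrow> 'a \<Rightarrow>\<^sub>L 'b) (h'' :: 'a \<Rightarrow> 'a \<Rightarrow>\<^sub>L ('a \<Rightarrow>\<^sub>L 'b)).
        (\<forall>x\<in>X. (h has_derivative blinfun_apply (h' x)) (at x) \<and>
               (h' has_derivative blinfun_apply (h'' x)) (at x)) \<and>
        continuous_on X h'')"


section \<open>Manifolds and maps of class \<open>C\<^sup>2\<close>\<close>

type_synonym ('p, 'e) chart = "'p set \<times> ('p \<Rightarrow> 'e)"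

text \<open>The inverse of the chart map, defined on its image.\<close>

definition chart_inv :: "('p, 'e) chart \<Rightarrow> 'e \<Rightarrow> 'p" where
  "chart_inv c = inv_into (fst c) (snd c)"

definition is_chart :: "('p::topological_space, 'e::topological_space) chart \<Rightarrow> bool" where
  "is_chart c \<longleftrightarrow> open (fst c) \<and> open (snd c ` fst c) \<and>
     homeomorphism (fst c) (snd c ` fst c) (snd c) (chart_inv c)"

definition C2_compatible ::
  "('p, 'e::real_normed_vector) chart \<Rightarrow> ('p, 'e) chart \<Rightarrow> bool" where
  "C2_compatible c d \<longleftrightarrow>
     C2_on (snd c ` (fst c \<inter> fst d)) (snd d \<circ> chart_inv c) \<and>
     C2_on (snd d ` (fst c \<inter> fst d)) (snd c \<circ> chart_inv d)"

text \<open>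
  The manifold is the whole (second countable Hausdorff) type \<open>'p\<close>, its differentiable structure
  is given by a maximal atlas, so that the charts of the manifold are the elements of the atlas.
\<close>

definition C2_manifold ::
  "('p::{t2_space, second_countable_topology}, 'e::{real_inner, heine_borel}) chart set \<Rightarrow> bool" where
  "C2_manifold \<A> \<longleftrightarrow>
     (\<forall>c\<in>\<A>. is_chart c) \<and>
     (\<Union>c\<in>\<A>. fst c) = UNIV \<and>
     (\<forall>c\<in>\<A>. \<forall>d\<in>\<A>. C2_compatible c d) \<and>
     (\<forall>c. is_chart c \<and> (\<forall>d\<in>\<A>. C2_compatible c d) \<longrightarrow> c \<in> \<A>)"

definition charts_at :: "('p, 'e) chart set \<Rightarrow> 'p \<Rightarrow> ('p, 'e) chart set" where
  "charts_at \<A> p = {c \<in> \<A>. p \<in> fst c}"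

text \<open>\<open>C\<^sup>2\<close>-maps from an open subset \<open>U\<close> of a manifold to a normed vector space.\<close>

definition C2_fun_on ::
  "('p, 'e::real_normed_vector) chart set \<Rightarrow> 'p set \<Rightarrow> ('p \<Rightarrow> 'b::real_normed_vector) \<Rightarrow> bool" where
  "C2_fun_on \<A> U h \<longleftrightarrow> (\<forall>c\<in>\<A>. C2_on (snd c ` (fst c \<inter> U)) (h \<circ> chart_inv c))"

definition C2_map ::
  "('p::topological_space, 'e::real_normed_vector) chart set \<Rightarrow>
   ('q::topological_space, 'f::real_normed_vector) chart set \<Rightarrow> ('p \<Rightarrow> 'q) \<Rightarrow> bool" where
  "C2_map \<A> \<B> g \<longleftrightarrow> continuous_on UNIV g \<and>
     (\<forall>c\<in>\<A>. \<forall>d\<in>\<B>. C2_on (snd c ` (fst c \<inter> g -` fst d)) (snd d \<circ> g \<circ> chart_inv c))"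


section \<open>Tangent spaces\<close>

text \<open>The pointwise vector space structure on functions.\<close>

instantiation "fun" :: (type, scaleR) scaleR
begin

definition scaleR_fun :: "real \<Rightarrow> ('a \<Rightarrow> 'b) \<Rightarrow> 'a \<Rightarrow> 'b" where
  "scaleR_fun r v = (\<lambda>x. r *\<^sub>R v x)"

instance ..

end

instance "fun" :: (type, real_vector) real_vector
  by standard (simp_all add: scaleR_fun_def fun_eq_iff algebra_simps)

text \<open>
  A tangent vector at \<open>p\<close> is the family \<open>v\<close> of its representatives \<open>v c\<close> in the charts \<open>c\<close> around
  \<open>p\<close>, which transform by the derivatives of the changes of coordinates; it is extended by \<open>0\<close> to
  all other \<open>c\<close>.  The tangent space is a linear subspace of a function space, with zero vector
  \<open>0\<close>.  The product topology induces its canonical topology, because each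
  \<open>v \<mapsto> v c\<close> with \<open>c\<close> around \<open>p\<close> is a linear homeomorphism onto the model space.
\<close>

type_synonym ('p, 'e) tangent = "('p, 'e) chart \<Rightarrow> 'e"

definition tangent_space ::
  "('p, 'e::real_normed_vector) chart set \<Rightarrow> 'p \<Rightarrow> ('p, 'e) tangent set" where
  "tangent_space \<A> p =
     {v. (\<forall>c. c \<notin> charts_at \<A> p \<longrightarrow> v c = 0) \<and>
         (\<forall>c\<in>charts_at \<A> p. \<forall>d\<in>charts_at \<A> p.
            v d = frechet_derivative (snd d \<circ> chart_inv c) (at (snd c p)) (v c))}"

text \<open>The tangent vector at \<open>p\<close> with representative \<open>x\<close> in the chart \<open>c\<close>.\<close>

definition tangent_vec ::
  "('p, 'e::real_normed_vector) chart set \<Rightarrow> 'p \<Rightarrow> ('p, 'e) chart \<Rightarrow> 'e \<Rightarrow> ('p, 'e) tangent" where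
  "tangent_vec \<A> p c x = (THE v. v \<in> tangent_space \<A> p \<and> v c = x)"

definition cotangent_space ::
  "('p, 'e::real_normed_vector) chart set \<Rightarrow> 'p \<Rightarrow> (('p, 'e) tangent \<Rightarrow> real) set" where
  "cotangent_space \<A> p =
     {\<mu>. (\<forall>v\<in>tangent_space \<A> p. \<forall>w\<in>tangent_space \<A> p. \<mu> (v + w) = \<mu> v + \<mu> w) \<and>
         (\<forall>r. \<forall>v\<in>tangent_space \<A> p. \<mu> (r *\<^sub>R v) = r * \<mu> v)}"

text \<open>
  Derivatives are computed in some charts around the points; by the chain rule they do not depend
  on the charts.
\<close>

definition some_chart :: "('p, 'e) chart set \<Rightarrow> 'p \<Rightarrow> ('p, 'e) chart" where
  "some_chart \<A> p = (SOME c. c \<in> charts_at \<A> p)"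

text \<open>The derivative \<open>g'(p) : T\<^sub>p M \<rightarrow> T\<^bsub>g(p)\<^esub> N\<close> of a map between manifolds.\<close>

definition map_deriv ::
  "('p, 'e::real_normed_vector) chart set \<Rightarrow> ('q, 'f::real_normed_vector) chart set \<Rightarrow>
   ('p \<Rightarrow> 'q) \<Rightarrow> 'p \<Rightarrow> ('p, 'e) tangent \<Rightarrow> ('q, 'f) tangent" where
  "map_deriv \<A> \<B> g p v =
     (let c = some_chart \<A> p; d = some_chart \<B> (g p) in
      tangent_vec \<B> (g p) d
        (frechet_derivative (snd d \<circ> g \<circ> chart_inv c) (at (snd c p)) (v c)))"

text \<open>
  The derivatives at \<open>0\<close> of maps \<open>T\<^sub>p M \<rightarrow> \<real>\<close> and \<open>T\<^sub>p M \<rightarrow> T\<^sub>q N\<close> defined near \<open>0\<close>.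
\<close>

definition tangent_fun_deriv ::
  "('p, 'e::real_normed_vector) chart set \<Rightarrow> 'p \<Rightarrow> (('p, 'e) tangent \<Rightarrow> real) \<Rightarrow>
   ('p, 'e) tangent \<Rightarrow> real" where
  "tangent_fun_deriv \<A> p h v =
     (let c = some_chart \<A> p in
      frechet_derivative (\<lambda>x. h (tangent_vec \<A> p c x)) (at 0) (v c))"

definition tangent_map_deriv ::
  "('p, 'e::real_normed_vector) chart set \<Rightarrow> 'p \<Rightarrow>
   ('q, 'f::real_normed_vector) chart set \<Rightarrow> 'q \<Rightarrow>
   (('p, 'e) tangent \<Rightarrow> ('q, 'f) tangent) \<Rightarrow> ('p, 'e) tangent \<Rightarrow> ('q, 'f) tangent" where
  "tangent_map_deriv \<A> p \<B> q h v =
     (let c = some_chart \<A> p; d = some_chart \<B> q in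
      tangent_vec \<B> q d
        (frechet_derivative (\<lambda>x. h (tangent_vec \<A> p c x) d) (at 0) (v c)))"


section \<open>Submanifolds with corners\<close>

text \<open>
  The set \<open>{x. W x = 0, A x \<le> 0}\<close>, where \<open>A\<close> is given by its matrix entries \<open>A i j\<close>,
  \<open>i < l\<close>, \<open>j < n\<close>.
\<close>

definition corner_cone ::
  "(nat \<Rightarrow> 'f::real_inner) \<Rightarrow> nat \<Rightarrow> nat \<Rightarrow> nat \<Rightarrow> (nat \<Rightarrow> nat \<Rightarrow> real) \<Rightarrow> 'f set" where
  "corner_cone e n k l A =
     {x. (\<forall>j\<in>{k..<n}. x \<bullet> e j = 0) \<and> (\<forall>i<l. (\<Sum>j<n. A i j * (x \<bullet> e j)) \<le> 0)}"

text \<open>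
  Surjectivity of \<open>A : \<real>\<^sup>k \<times> {0} \<rightarrow> \<real>\<^sup>l\<close>; elements of \<open>\<real>\<^sup>l\<close> are given by their entries with index
  below \<open>l\<close>.
\<close>

definition surjective_matrix ::
  "(nat \<Rightarrow> 'f::real_inner) \<Rightarrow> nat \<Rightarrow> nat \<Rightarrow> nat \<Rightarrow> (nat \<Rightarrow> nat \<Rightarrow> real) \<Rightarrow> bool" where
  "surjective_matrix e n k l A \<longleftrightarrow>
     (\<forall>y :: nat \<Rightarrow> real. \<exists>x. (\<forall>j\<in>{k..<n}. x \<bullet> e j = 0) \<and>
        (\<forall>i<l. (\<Sum>j<n. A i j * (x \<bullet> e j)) = y i))"

definition adapted_chart ::
  "('q, 'f::real_inner) chart set \<Rightarrow> (nat \<Rightarrow> 'f) \<Rightarrow> nat \<Rightarrow> nat \<Rightarrow> 'q set \<Rightarrow> 'q \<Rightarrow>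
   ('q, 'f) chart \<Rightarrow> nat \<Rightarrow> (nat \<Rightarrow> nat \<Rightarrow> real) \<Rightarrow> bool" where
  "adapted_chart \<B> e n k K q c l A \<longleftrightarrow>
     c \<in> charts_at \<B> q \<and> snd c q = 0 \<and> l \<le> k \<and>
     (\<forall>i<l. \<forall>j\<in>{k..<n}. A i j = 0) \<and> surjective_matrix e n k l A \<and>
     snd c ` (K \<inter> fst c) = {x \<in> snd c ` fst c. x \<in> corner_cone e n k l A}"

definition submanifold_with_corners ::
  "('q, 'f::real_inner) chart set \<Rightarrow> (nat \<Rightarrow> 'f) \<Rightarrow> nat \<Rightarrow> nat \<Rightarrow> 'q set \<Rightarrow> bool" where
  "submanifold_with_corners \<B> e n k K \<longleftrightarrow>
     k \<le> n \<and> (\<forall>q\<in>K. \<exists>c l A. adapted_chart \<B> e n k K q c l A)"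

text \<open>The cone \<open>T\<^sup>i\<^sub>q K\<close>; it is independent of the adapted chart.\<close>

definition inner_tangent_cone ::
  "('q, 'f::real_inner) chart set \<Rightarrow> (nat \<Rightarrow> 'f) \<Rightarrow> nat \<Rightarrow> nat \<Rightarrow> 'q set \<Rightarrow> 'q \<Rightarrow>
   ('q, 'f) tangent set" where
  "inner_tangent_cone \<B> e n k K q =
     (let (c, l, A) = (SOME (c, l, A). adapted_chart \<B> e n k K q c l A) in
      {v \<in> tangent_space \<B> q. v c \<in> corner_cone e n k l A})"


section \<open>Local retractions and local linearizing maps\<close>

text \<open>
  The identification of \<open>T\<^sub>p M\<close> with the model space through a chart \<open>c\<close> is
  \<open>tangent_vec \<A> p c\<close>, with inverse \<open>v \<mapsto> v c\<close>.  A linear endomorphism of \<open>T\<^sub>p M\<close> is the identity iff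
  its representative with respect to \<open>c\<close> is the identity.
\<close>

definition local_retraction ::
  "('p::topological_space, 'e::real_normed_vector) chart set \<Rightarrow> 'p \<Rightarrow>
   ('p, 'e) tangent set \<Rightarrow> (('p, 'e) tangent \<Rightarrow> 'p) \<Rightarrow> bool" where
  "local_retraction \<A> p V R \<longleftrightarrow>
     openin (top_of_set (tangent_space \<A> p)) V \<and> 0 \<in> V \<and>
     continuous_on V R \<and>
     (\<forall>c\<in>charts_at \<A> p. \<forall>d\<in>\<A>.
        C2_on {x. tangent_vec \<A> p c x \<in> V \<and> R (tangent_vec \<A> p c x) \<in> fst d}
          (snd d \<circ> R \<circ> tangent_vec \<A> p c)) \<and>
     R 0 = p \<and>
     (\<forall>c\<in>charts_at \<A> p. ((snd c \<circ> R \<circ> tangent_vec \<A> p c) has_derivative id) (at 0))"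

definition local_linearizing_map ::
  "('q::topological_space, 'f::real_normed_vector) chart set \<Rightarrow> 'q \<Rightarrow>
   'q set \<Rightarrow> ('q \<Rightarrow> ('q, 'f) tangent) \<Rightarrow> bool" where
  "local_linearizing_map \<B> q U S \<longleftrightarrow>
     open U \<and> q \<in> U \<and> S ` U \<subseteq> tangent_space \<B> q \<and>
     (\<forall>c\<in>charts_at \<B> q. C2_fun_on \<B> U (\<lambda>y. S y c)) \<and>
     S q = 0 \<and>
     (\<forall>c\<in>charts_at \<B> q. (((\<lambda>y. S y c) \<circ> chart_inv c) has_derivative id) (at (snd c q)))"

definition adapted_linearizing_map ::
  "('q::topological_space, 'f::real_inner) chart set \<Rightarrow> (nat \<Rightarrow> 'f) \<Rightarrow> nat \<Rightarrow> nat \<Rightarrow> 'q set \<Rightarrow> 'q \<Rightarrow>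
   'q set \<Rightarrow> ('q \<Rightarrow> ('q, 'f) tangent) \<Rightarrow> bool" where
  "adapted_linearizing_map \<B> e n k K q U S \<longleftrightarrow>
     local_linearizing_map \<B> q U S \<and>
     S ` (U \<inter> K) = S ` U \<inter> inner_tangent_cone \<B> e n k K q"


section \<open>Optimization\<close>

definition local_minimizer :: "('a::topological_space \<Rightarrow> real) \<Rightarrow> 'a set \<Rightarrow> 'a \<Rightarrow> bool" where
  "local_minimizer h X x \<longleftrightarrow>
     x \<in> X \<and> (\<exists>W. open W \<and> x \<in> W \<and> (\<forall>y\<in>X \<inter> W. h x \<le> h y))"

text \<open>The tangent cone at \<open>0\<close> of a subset \<open>C\<close> of the vector space \<open>X\<close>.\<close>

definition tangent_cone_0 :: "'v::{real_vector, topological_space} set \<Rightarrow> 'v set \<Rightarrow> 'v set" where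
  "tangent_cone_0 X C =
     {v \<in> X. \<exists>(t :: nat \<Rightarrow> real) (x :: nat \<Rightarrow> 'v).
        (\<forall>j. t j > 0) \<and> decseq t \<and> t \<longlonglongrightarrow> 0 \<and> (\<forall>j. x j \<in> X) \<and> x \<longlonglongrightarrow> v \<and>
        (\<forall>j. t j *\<^sub>R x j \<in> C)}"

definition polar_cone ::
  "('p, 'e::real_normed_vector) chart set \<Rightarrow> 'p \<Rightarrow> ('p, 'e) tangent set \<Rightarrow>
   (('p, 'e) tangent \<Rightarrow> real) set" where
  "polar_cone \<A> p C = {\<mu> \<in> cotangent_space \<A> p. \<forall>s\<in>C. \<mu> s \<le> 0}"

end

theory Submission
  imports Defs
begin

text \<open>
  A retraction has derivative \<open>id\<close> at \<open>0\<close>, so it maps neighbourhoods of \<open>0\<close> onto neighbourhoods of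
  \<open>p\<close>, and local minimality can be transported along it.  Let \<open>h\<close> and \<open>G\<close> represent the pulled back
  objective and constraint in charts, adapted at \<open>g p\<close>.  The constraint is
  \<open>G x \<in> C\<close> with a polyhedral cone \<open>C\<close> given by equations and inequalities whose normals are
  linearly independent.  ZKRCQ then is the Mangasarian--Fromovitz condition: the
  linearized equations are solvable, and some direction \<open>u\<^sub>0\<close> makes all inequalities strict.  A direction
  with strict inequalities is tangent to a feasible curve, on which \<open>h\<close> cannot decrease; by
  perturbing with \<open>u\<^sub>0\<close> the same inequality \<open>h' u \<ge> 0\<close> holds for all \<open>u\<close> with \<open>G' u \<in> C\<close>, and Farkas'
  lemma yields the multiplier.  Since the linearizing map covers a neighbourhood of \<open>0\<close>, the sets
  \<open>S (K \<inter> U)\<close> and \<open>T\<^sup>i K\<close> have the same germ at \<open>0\<close>, hence the same tangent cone.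
\<close>

section \<open>Local inversion of \<open>C\<^sup>1\<close>-maps\<close>

text \<open>The first-order part of \<open>C2_on\<close>. Continuity of the derivative in operator
  norm is what the contraction argument uses, and the class is closed under composition by the chain
  rule.\<close>

definition C1_on :: "'a::real_normed_vector set \<Rightarrow> ('a \<Rightarrow> 'b::real_normed_vector) \<Rightarrow> bool" where
  "C1_on X h \<longleftrightarrow>
     (\<exists>h' :: 'a \<Rightarrow> 'a \<Rightarrow>\<^sub>L 'b.
        (\<forall>x\<in>X. (h has_derivative blinfun_apply (h' x)) (at x)) \<and> continuous_on X h')"

lemma C2_on_imp_C1_on: "C2_on X h \<Longrightarrow> C1_on X h"
  unfolding C2_on_def C1_on_def
  by (meson continuous_at_imp_continuous_on has_derivative_continuous)

lemma C1_on_subset: "C1_on X h \<Longrightarrow> Y \<subseteq> X \<Longrightarrow> C1_on Y h"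
  unfolding C1_on_def by (meson continuous_on_subset subsetD)

lemma C1_on_compose:
  assumes a: "C1_on X a" and b: "C1_on Y b" and im: "a ` X \<subseteq> Y"
  shows "C1_on X (b \<circ> a)"
proof -
  obtain a' where a': "\<And>x. x \<in> X \<Longrightarrow> (a has_derivative blinfun_apply (a' x)) (at x)"
    and ca': "continuous_on X a'"
    using a unfolding C1_on_def by blast
  obtain b' where b': "\<And>x. x \<in> Y \<Longrightarrow> (b has_derivative blinfun_apply (b' x)) (at x)"
    and cb': "continuous_on Y b'"
    using b unfolding C1_on_def by blast
  have ca: "continuous_on X a"
    by (meson a' continuous_at_imp_continuous_on has_derivative_continuous)
  have "((b \<circ> a) has_derivative blinfun_apply (b' (a x) o\<^sub>L a' x)) (at x)" if "x \<in> X" for x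
    using diff_chain_at[OF a'[OF that] b'] im that
    by (simp add: blinfun_compose.rep_eq image_subset_iff)
  moreover have "continuous_on X (\<lambda>x. b' (a x) o\<^sub>L a' x)"
    by (intro bounded_bilinear.continuous_on[OF bounded_bilinear_blinfun_compose] ca'
        continuous_on_compose2[OF cb' ca im])
  ultimately show ?thesis
    unfolding C1_on_def by (intro exI[of _ "\<lambda>x. b' (a x) o\<^sub>L a' x"]) simp
qed

lemma C1_on_cong:
  assumes "C1_on X a" "open X" "\<And>x. x \<in> X \<Longrightarrow> a x = b x"
  shows "C1_on X b"
  using assms unfolding C1_on_def
  by (metis (no_types, lifting) has_derivative_transform_within_open)

lemma C1_on_has_derivative:
  assumes "C1_on X h" "x \<in> X"
  shows "(h has_derivative frechet_derivative h (at x)) (at x)"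
  using assms unfolding C1_on_def
  by (metis differentiableI frechet_derivative_works)

text \<open>A solution of \<open>\<phi> x = y\<close> is a fixed point of \<open>x \<mapsto> x - \<phi> x + y\<close>, which is a contraction of a closed
  ball around \<open>x0\<close>.\<close>

lemma local_right_inverse:
  fixes \<phi> :: "'a::{real_normed_vector, heine_borel} \<Rightarrow> 'a"
  assumes C1: "C1_on X \<phi>" and X: "open X" "x0 \<in> X" and id: "(\<phi> has_derivative id) (at x0)"
  shows "\<exists>\<delta>>0. \<forall>y. norm (y - \<phi> x0) < \<delta> \<longrightarrow>
    (\<exists>x\<in>X. \<phi> x = y \<and> norm (x - x0) \<le> 2 * norm (y - \<phi> x0))"
proof -
  obtain h' where h': "\<And>x. x \<in> X \<Longrightarrow> (\<phi> has_derivative blinfun_apply (h' x)) (at x)"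
    and ch': "continuous_on X h'"
    using C1 unfolding C1_on_def by blast
  have h'0: "h' x0 = id_blinfun"
    using has_derivative_unique[OF h'[OF X(2)] id] by (intro blinfun_eqI) simp
  have "isCont h' x0"
    using ch' X continuous_on_eq_continuous_at by blast
  then obtain d where d: "d > 0" "\<And>x. dist x x0 < d \<Longrightarrow> dist (h' x) (h' x0) < 1/2"
    unfolding continuous_at_eps_delta by (metis half_gt_zero zero_less_one)
  obtain d' where d': "d' > 0" "ball x0 d' \<subseteq> X"
    using X open_contains_ball by blast
  \<comment> \<open>Halving makes the closed ball fit into both open balls: the one inside
    \<open>X\<close> and the one where \<open>h'\<close> is within \<open>1/2\<close> of the
    identity.\<close>
  define r where "r = min d d' / 2"
  have r: "r > 0" "cball x0 r \<subseteq> X" "\<And>x. x \<in> cball x0 r \<Longrightarrow> norm (id_blinfun - h' x) \<le> 1/2"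
  proof -
    show "r > 0" using d d' by (simp add: r_def)
    have "x \<in> ball x0 d' \<and> dist x x0 < d" if "x \<in> cball x0 r" for x
      using that d(1) d'(1) by (auto simp: r_def dist_commute min_def split: if_splits)
    then show "cball x0 r \<subseteq> X" "\<And>x. x \<in> cball x0 r \<Longrightarrow> norm (id_blinfun - h' x) \<le> 1/2"
      using d(2) d'(2) h'0 by (auto simp: dist_norm norm_minus_commute less_imp_le)
  qed
  \<comment> \<open>Mean value inequality on the convex ball, since \<open>x - \<phi> x\<close> has
    derivative \<open>id_blinfun - h' x\<close>.\<close>
  have lip: "norm ((x - \<phi> x) - (x' - \<phi> x')) \<le> 1/2 * norm (x - x')"
    if "x \<in> cball x0 r" "x' \<in> cball x0 r" for x x'
  proof (rule differentiable_bound[of "cball x0 r" _ "\<lambda>x. blinfun_apply (id_blinfun - h' x)"])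
    fix z assume z: "z \<in> cball x0 r"
    then have "z \<in> X" using r(2) by blast
    have "((\<lambda>x. x - \<phi> x) has_derivative (\<lambda>v. v - h' z v)) (at z)"
      by (intro derivative_intros h' \<open>z \<in> X\<close>)
    then show "((\<lambda>x. x - \<phi> x) has_derivative blinfun_apply (id_blinfun - h' z))
        (at z within cball x0 r)"
      by (metis (no_types, lifting) blinfun.diff_left blinfun_apply_id_blinfun ext
          has_derivative_at_withinI)
    show "onorm (blinfun_apply (id_blinfun - h' z)) \<le> 1/2"
      using r(3)[OF z] by (simp add: norm_blinfun.rep_eq)
  qed (use that in auto)
  show ?thesis
  proof (intro exI[of _ "r/2"] conjI allI impI)
    show "r/2 > 0" using r(1) by simp
    fix y assume y: "norm (y - \<phi> x0) < r/2"
    \<comment> \<open>Running the contraction on this smaller ball instead of radius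
      \<open>r\<close> yields the linear bound on the solution; the factor 2 comes from the
      contraction constant \<open>1/2\<close>.\<close>
    define s where "s = 2 * norm (y - \<phi> x0)"
    have s: "0 \<le> s" "cball x0 s \<subseteq> cball x0 r"
      using y by (auto simp: s_def)
    have "\<exists>!x. x \<in> cball x0 s \<and> x - \<phi> x + y = x"
    proof (rule Banach_fix[of _ "1/2"])
      show "complete (cball x0 s)" by (simp add: complete_eq_closed)
      show "cball x0 s \<noteq> {}" using s by auto
      show "(\<lambda>x. x - \<phi> x + y) ` cball x0 s \<subseteq> cball x0 s"
      proof clarify
        fix x assume x: "x \<in> cball x0 s"
        have "norm (x - \<phi> x + y - x0) = norm (((x - \<phi> x) - (x0 - \<phi> x0)) + (y - \<phi> x0))"
          by (simp add: algebra_simps)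
        also have "\<dots> \<le> 1/2 * norm (x - x0) + norm (y - \<phi> x0)"
          using lip[of x x0] x s r(1) by (intro norm_triangle_le) auto
        also have "\<dots> \<le> s"
          using x by (simp add: s_def dist_norm norm_minus_commute)
        finally show "x - \<phi> x + y \<in> cball x0 s"
          by (simp add: dist_norm norm_minus_commute)
      qed
      show "dist (x - \<phi> x + y) (x' - \<phi> x' + y) \<le> 1/2 * dist x x'"
        if "x \<in> cball x0 s" "x' \<in> cball x0 s" for x x'
        using lip[of x x'] that s(2) by (simp add: dist_norm subset_eq algebra_simps)
    qed auto
    then obtain x where x: "x \<in> cball x0 s" "x - \<phi> x + y = x" by blast
    have "\<phi> x = y" using x(2) by (simp add: algebra_simps)
    then show "\<exists>x\<in>X. \<phi> x = y \<and> norm (x - x0) \<le> 2 * norm (y - \<phi> x0)"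
      using x(1) s r(2) by (intro bexI[of _ x]) (auto simp: s_def dist_norm norm_minus_commute)
  qed
qed

text \<open>Preimages of \<open>t *\<^sub>R u\<close> are merely chosen, not obtained from a smooth
  inverse. The linear bound of \<open>local_right_inverse\<close> makes them O(t), so
  differentiability of \<open>\<psi>\<close> at 0 gives \<xi>(t) = t u + o(t), which is the
  one-sided derivative.\<close>

lemma right_inverse_curve:
  fixes \<psi> :: "'a::{real_normed_vector, heine_borel} \<Rightarrow> 'a"
  assumes C1: "C1_on X \<psi>" and X: "open X" "0 \<in> X" and id: "(\<psi> has_derivative id) (at 0)"
    and \<psi>0: "\<psi> 0 = 0"
  obtains \<xi> :: "real \<Rightarrow> 'a" and \<delta> where "\<delta> > 0" "\<xi> 0 = 0"
    "(\<xi> has_vector_derivative u) (at 0 within {0..})"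
    "\<And>t. 0 \<le> t \<Longrightarrow> t < \<delta> \<Longrightarrow> \<xi> t \<in> X \<and> \<psi> (\<xi> t) = t *\<^sub>R u"
proof -
  obtain \<delta>0 where \<delta>0: "\<delta>0 > 0"
    "\<And>y. norm y < \<delta>0 \<Longrightarrow> \<exists>x\<in>X. \<psi> x = y \<and> norm x \<le> 2 * norm y"
    using local_right_inverse[OF C1 X id] \<psi>0 by auto
  \<comment> \<open>A positive bound, so that dividing by it is also safe when
    \<open>u = 0\<close>.\<close>
  obtain c where c: "c > 0" "norm u \<le> c"
    using zero_less_one gt_ex by (metis less_imp_le max_less_iff_conj)
  define \<delta> where "\<delta> = \<delta>0 / c"
  have \<delta>: "\<delta> > 0" using \<delta>0(1) c by (simp add: \<delta>_def)
  have small: "norm (t *\<^sub>R u) < \<delta>0" if "0 \<le> t" "t < \<delta>" for t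
  proof -
    have "norm (t *\<^sub>R u) \<le> t * c" using that c by (simp add: mult_left_mono)
    also have "\<dots> < \<delta>0" using that(2) c by (simp add: \<delta>_def pos_less_divide_eq)
    finally show ?thesis .
  qed
  have "\<forall>t. \<exists>x. 0 \<le> t \<and> t < \<delta> \<longrightarrow> x \<in> X \<and> \<psi> x = t *\<^sub>R u \<and> norm x \<le> 2 * norm (t *\<^sub>R u)"
    using \<delta>0(2) small by blast
  then obtain \<xi> where \<xi>: "\<And>t. 0 \<le> t \<Longrightarrow> t < \<delta> \<Longrightarrow>
      \<xi> t \<in> X \<and> \<psi> (\<xi> t) = t *\<^sub>R u \<and> norm (\<xi> t) \<le> 2 * norm (t *\<^sub>R u)"
    by metis
  have \<xi>0: "\<xi> 0 = 0" using \<xi>[of 0] \<delta> by simp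
  have "(\<xi> has_derivative (\<lambda>t. t *\<^sub>R u)) (at 0 within {0..})"
    unfolding has_derivative_within_alt
  proof (intro conjI allI impI)
    show "bounded_linear (\<lambda>t. t *\<^sub>R u)" by (rule bounded_linear_scaleR_left)
    fix e :: real assume "e > 0"
    \<comment> \<open>The norm of \<open>\<xi> t\<close> is at most \<open>2 * (t * c)\<close>, so
      this scaling turns the error \<open>e' * norm (\<xi> t)\<close> into at most
      \<open>e * t\<close>.\<close>
    define e' where "e' = e / (2 * c)"
    have e': "e' > 0" using \<open>e > 0\<close> c by (simp add: e'_def)
    obtain d where d: "d > 0" "\<And>x. norm x < d \<Longrightarrow> norm (\<psi> x - x) \<le> e' * norm x"
      using id e' \<psi>0 unfolding has_derivative_at_alt by fastforce
    define d' where "d' = min \<delta> (d / (2 * c))"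
    show "\<exists>d>0. \<forall>y\<in>{0..}. norm (y - 0) < d \<longrightarrow>
        norm (\<xi> y - \<xi> 0 - (y - 0) *\<^sub>R u) \<le> e * norm (y - 0)"
    proof (intro exI[of _ d'] conjI ballI impI)
      show "d' > 0" using \<delta> d(1) c by (simp add: d'_def)
      fix t :: real assume t: "t \<in> {0..}" "norm (t - 0) < d'"
      have t': "0 \<le> t" "t < \<delta>" "t < d / (2 * c)" using t by (auto simp: d'_def)
      have n: "norm (\<xi> t) \<le> 2 * (t * c)"
        using \<xi>[OF t'(1,2)] t' c(2) mult_left_mono[of "norm u" c t] by simp
      also have "\<dots> < d"
        using t'(3) c(1) by (simp add: pos_less_divide_eq mult.assoc mult.left_commute)
      finally have "norm (\<psi> (\<xi> t) - \<xi> t) \<le> e' * norm (\<xi> t)" by (rule d(2))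
      also have "\<dots> \<le> e' * (2 * (t * c))"
        using n e' by (intro mult_left_mono) auto
      also have "\<dots> = e * t"
        using c(1) by (simp add: e'_def)
      finally show "norm (\<xi> t - \<xi> 0 - (t - 0) *\<^sub>R u) \<le> e * norm (t - 0)"
        using \<xi>[OF t'(1,2)] \<xi>0 t' by (simp add: norm_minus_commute)
    qed
  qed
  then show ?thesis
    using that[of \<delta> \<xi>] \<delta> \<xi>0 \<xi> unfolding has_vector_derivative_def by blast
qed

section \<open>First-order conditions under a polyhedral constraint\<close>

text \<open>Induction on the number of functionals. If the last one matters for the implication,
  projecting along a direction that violates only it reduces the claim to its kernel, and its
  coefficient is read off from that direction.\<close>

lemma farkas:
  fixes f :: "'a::real_vector \<Rightarrow> real" and g :: "nat \<Rightarrow> 'a \<Rightarrow> real"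
  assumes "linear f" "\<And>i. i < N \<Longrightarrow> linear (g i)"
    and "\<And>u. (\<And>i. i < N \<Longrightarrow> g i u \<le> 0) \<Longrightarrow> f u \<le> 0"
  shows "\<exists>l. (\<forall>i<N. l i \<ge> 0) \<and> (\<forall>u. f u = (\<Sum>i<N. l i * g i u))"
  using assms
proof (induction N arbitrary: f g)
  case 0
  have "f u = 0" for u
    using "0.prems"(3)[of u] "0.prems"(3)[of "- u"] linear_neg[OF "0.prems"(1), of u] by simp
  then show ?case by simp
next
  case (Suc N)
  show ?case
  proof (cases "\<forall>u. (\<forall>i<N. g i u \<le> 0) \<longrightarrow> f u \<le> 0")
    \<comment> \<open>The first \<open>N\<close> inequalities already suffice, so the last
      functional receives coefficient 0.\<close>
    case True
    then obtain l where l: "\<forall>i<N. l i \<ge> 0" "\<And>u. f u = (\<Sum>i<N. l i * g i u)"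
      using Suc.IH[OF Suc.prems(1), of g] Suc.prems(2) by auto
    show ?thesis
      using l by (intro exI[of _ "l(N := 0)"]) auto
  next
    case False
    then obtain u1 where u1: "\<And>i. i < N \<Longrightarrow> g i u1 \<le> 0" "f u1 > 0"
      by (auto simp: not_le)
    have gN: "g N u1 > 0"
      using Suc.prems(3)[of u1] u1 by (metis less_SucE not_le)
    define u0 where "u0 = inverse (g N u1) *\<^sub>R u1"
    have lin: "linear (g i)" if "i \<le> N" for i using Suc.prems(2) that by simp
    have u0: "\<And>i. i < N \<Longrightarrow> g i u0 \<le> 0" "f u0 > 0" "g N u0 = 1"
      using gN u1 lin by (auto simp: u0_def linear_scale Suc.prems(1) mult_nonneg_nonpos)
    \<comment> \<open>The projection along \<open>u0\<close> onto the kernel of \<open>g N\<close>;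
      on its range the last inequality holds with equality, so the induction hypothesis applies to
      \<open>f \<circ> \<pi>\<close>.\<close>
    define \<pi> where "\<pi> u = u - g N u *\<^sub>R u0" for u
    have lin\<pi>: "linear \<pi>"
      by (rule linearI)
        (simp_all add: \<pi>_def linear_add[OF lin] linear_scale[OF lin] algebra_simps)
    have "\<exists>l. (\<forall>i<N. l i \<ge> 0) \<and> (\<forall>u. (f \<circ> \<pi>) u = (\<Sum>i<N. l i * (g i \<circ> \<pi>) u))"
    proof (rule Suc.IH)
      show "linear (f \<circ> \<pi>)" using linear_compose[OF lin\<pi> Suc.prems(1)] .
      show "linear (g i \<circ> \<pi>)" if "i < N" for i
        using linear_compose[OF lin\<pi> lin] that by simp
      fix u assume *: "\<And>i. i < N \<Longrightarrow> (g i \<circ> \<pi>) u \<le> 0"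
      have "g N (\<pi> u) = 0"
        by (simp add: \<pi>_def linear_diff[OF lin] linear_scale[OF lin] u0)
      then show "(f \<circ> \<pi>) u \<le> 0"
        using Suc.prems(3)[of "\<pi> u"] * by (metis comp_apply less_SucE order_refl)
    qed
    then obtain l where l: "\<And>i. i < N \<Longrightarrow> l i \<ge> 0"
      "\<And>u. f (\<pi> u) = (\<Sum>i<N. l i * g i (\<pi> u))" by auto
    \<comment> \<open>The coefficient of \<open>g N\<close> that appears when u = \<pi>(u) + g_N(u)
      u_0 is substituted; it is nonnegative because \<open>f u0 > 0\<close> while each
      \<open>l i * g i u0\<close> is at most 0.\<close>
    define b where "b = f u0 - (\<Sum>i<N. l i * g i u0)"
    have "(\<Sum>i<N. l i * g i u0) \<le> 0"
      using l(1) u0(1) by (intro sum_nonpos) (simp add: mult_nonneg_nonpos)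
    then have b: "b \<ge> 0" using u0(2) by (simp add: b_def)
    have "f u = (\<Sum>i<N. l i * g i u) + b * g N u" for u
    proof -
      have "f u = f (\<pi> u) + g N u * f u0"
        by (simp add: \<pi>_def linear_diff[OF Suc.prems(1)] linear_scale[OF Suc.prems(1)])
      also have "f (\<pi> u) = (\<Sum>i<N. l i * (g i u - g N u * g i u0))"
        unfolding l(2)
        by (intro sum.cong) (simp_all add: \<pi>_def linear_diff[OF lin] linear_scale[OF lin])
      also have "\<dots> = (\<Sum>i<N. l i * g i u) - g N u * (\<Sum>i<N. l i * g i u0)"
        by (simp add: sum_subtractf sum_distrib_left algebra_simps)
      finally show ?thesis by (simp add: b_def algebra_simps)
    qed
    then show ?thesis
      using l(1) b by (intro exI[of _ "l(N := b)"]) auto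
  qed
qed

text \<open>By the chain rule the composite has one-sided derivative \<open>\<Phi>' u\<close> at 0,
  which is negative. This serves both the objective and every inequality of the cone.\<close>

lemma eventually_decreasing_along_curve:
  fixes \<xi> :: "real \<Rightarrow> 'a::real_normed_vector" and \<Phi> :: "'a \<Rightarrow> real"
  assumes \<Phi>: "(\<Phi> has_derivative \<Phi>') (at 0)" "\<Phi>' u < 0"
    and \<xi>: "(\<xi> has_vector_derivative u) (at 0 within {0..})" "\<xi> 0 = 0"
  shows "\<forall>\<^sub>F t in at_right 0. \<Phi> (\<xi> t) < \<Phi> 0"
proof -
  have "((\<Phi> \<circ> \<xi>) has_derivative (\<Phi>' \<circ> (\<lambda>t. t *\<^sub>R u))) (at 0 within {0..})"
    using \<Phi>(1) \<xi> unfolding has_vector_derivative_def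
    by (intro diff_chain_within) (auto intro: has_derivative_at_withinI)
  moreover have "\<Phi>' \<circ> (\<lambda>t. t *\<^sub>R u) = (*) (\<Phi>' u)"
    using linear_scale[OF has_derivative_linear[OF \<Phi>(1)]] by (auto simp: fun_eq_iff)
  ultimately have "((\<Phi> \<circ> \<xi>) has_real_derivative \<Phi>' u) (at 0 within {0..})"
    by (simp add: has_field_derivative_def)
  from has_real_derivative_neg_dec_right[OF this \<Phi>(2)] obtain d where
    "d > 0" "\<And>t. 0 < t \<Longrightarrow> t < d \<Longrightarrow> \<Phi> (\<xi> t) < \<Phi> 0"
    using \<xi>(2) by auto
  then show ?thesis
    unfolding eventually_at_right_field by blast
qed

text \<open>The multiplier rule in coordinates: \<open>cq\<close> is ZKRCQ read in an adapted chart,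
  and the inner product with \<open>\<mu>\<close> represents the covector.\<close>

lemma kkt_corner_cone:
  fixes h :: "'a::{real_normed_vector, heine_borel} \<Rightarrow> real" and G :: "'a \<Rightarrow> 'b::real_inner"
  assumes e: "coordinate_basis n e" and surj: "surjective_matrix e n k l A"
    and X: "open X" "0 \<in> X" and G: "C1_on X G" "(G has_derivative D) (at 0)" "G 0 = 0"
    and h: "(h has_derivative h') (at 0)"
    and min: "\<And>x. x \<in> X \<Longrightarrow> G x \<in> corner_cone e n k l A \<Longrightarrow> h 0 \<le> h x"
    and cq: "\<And>w. \<exists>u. \<exists>c\<in>corner_cone e n k l A. w = D u - c"
  shows "\<exists>\<mu>. (\<forall>u. h' u + \<mu> \<bullet> D u = 0) \<and> (\<forall>c\<in>corner_cone e n k l A. \<mu> \<bullet> c \<le> 0)"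
proof -
  define J where "J = {k..<n}"
  \<comment> \<open>The rows of \<open>A\<close> as vectors of the model space, so that inequalities
    become inner products.\<close>
  define a where "a i = (\<Sum>j<n. A i j *\<^sub>R e j)" for i
  have a: "(\<Sum>j<n. A i j * (x \<bullet> e j)) = a i \<bullet> x" for i x
    by (simp add: a_def inner_sum_left inner_commute[of x])
  have C: "corner_cone e n k l A = {x. (\<forall>j\<in>J. x \<bullet> e j = 0) \<and> (\<forall>i<l. a i \<bullet> x \<le> 0)}"
    by (simp add: corner_cone_def J_def a)
  have orth: "e i \<bullet> e j = (if i = j then 1 else 0)" if "i \<in> J" "j \<in> J" for i j
    using e that by (simp add: coordinate_basis_def J_def)
  have linD: "linear D" and bD: "bounded_linear D" and linh: "linear h'"
    using G(2) h by (auto intro: has_derivative_linear has_derivative_bounded_linear)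

  \<comment> \<open>Surjectivity of \<open>A\<close> gives \<open>z\<close> in the equations' kernel
    with every inequality equal to -1. Writing \<open>z = D u - c\<close> with \<open>c\<close> in
    the cone, \<open>D u = z + c\<close> keeps strictness.\<close>
  obtain u0 where u0: "\<And>j. j \<in> J \<Longrightarrow> D u0 \<bullet> e j = 0" "\<And>i. i < l \<Longrightarrow> a i \<bullet> D u0 < 0"
  proof -
    obtain z where z: "\<And>j. j \<in> J \<Longrightarrow> z \<bullet> e j = 0" "\<And>i. i < l \<Longrightarrow> a i \<bullet> z = -1"
      using surj[unfolded surjective_matrix_def, rule_format, of "\<lambda>_. -1"]
      unfolding a J_def by blast
    obtain u c where uc: "c \<in> corner_cone e n k l A" "z = D u - c"
      using cq by blast
    then have "D u = z + c" by simp
    then show ?thesis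
      using that[of u] z uc(1) by (fastforce simp: C inner_add_left inner_add_right)
  qed

  \<comment> \<open>Apply \<open>cq\<close> to \<open>e j\<close>: the cone element \<open>c\<close>
    has no \<open>J\<close>-coordinates, so \<open>D u\<close> and \<open>e j\<close> share
    theirs.\<close>
  have "\<exists>u. \<forall>i\<in>J. D u \<bullet> e i = (if i = j then 1 else 0)" if "j \<in> J" for j
  proof -
    obtain u c where uc: "c \<in> corner_cone e n k l A" "e j = D u - c"
      using cq by blast
    then have "D u = e j + c" by simp
    then show ?thesis
      using uc(1) orth[OF that] by (intro exI[of _ u]) (auto simp: C inner_add_left)
  qed
  then obtain v where v: "\<And>i j. i \<in> J \<Longrightarrow> j \<in> J \<Longrightarrow> D (v j) \<bullet> e i = (if i = j then 1 else 0)"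
    by metis
  define N where "N w = (\<Sum>j\<in>J. (w \<bullet> e j) *\<^sub>R v j)" for w
  have bN: "bounded_linear N"
    unfolding N_def by (intro bounded_linear_sum bounded_linear_scaleR_const bounded_linear_inner_left)
  have DN: "D (N w) \<bullet> e i = w \<bullet> e i" if "i \<in> J" for w i
  proof -
    have "D (N w) \<bullet> e i = (\<Sum>j\<in>J. (w \<bullet> e j) * (D (v j) \<bullet> e i))"
      by (simp add: N_def linear_sum[OF linD] linear_scale[OF linD] inner_sum_left)
    also have "\<dots> = (\<Sum>j\<in>J. if i = j then w \<bullet> e j else 0)"
      using v that by (intro sum.cong) auto
    also have "\<dots> = w \<bullet> e i" using that by (simp add: J_def)
    finally show ?thesis .
  qed

  text \<open>If \<open>\<psi> x = t *\<^sub>R u\<close> and \<open>D u\<close> satisfies the equations of the cone, then so does \<open>G x\<close>,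
    because \<open>N\<close> is a right inverse of \<open>D\<close> with respect to these equations.\<close>
  define \<psi> where "\<psi> x = x + N (G x - D x)" for x
  have C1\<psi>: "C1_on X \<psi>"
  proof -
    obtain G' where G': "\<And>x. x \<in> X \<Longrightarrow> (G has_derivative blinfun_apply (G' x)) (at x)"
      "continuous_on X G'"
      using G(1) unfolding C1_on_def by blast
    define \<psi>' where "\<psi>' x = id_blinfun + (Blinfun N o\<^sub>L (G' x - Blinfun D))" for x
    have "(\<psi> has_derivative blinfun_apply (\<psi>' x)) (at x)" if "x \<in> X" for x
    proof -
      have "(\<psi> has_derivative (\<lambda>v. v + N (G' x v - D v))) (at x)"
        unfolding \<psi>_def
        by (intro derivative_intros bounded_linear.has_derivative[OF bN] G' that
            bounded_linear_imp_has_derivative bD)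
      moreover have "blinfun_apply (\<psi>' x) = (\<lambda>v. v + N (G' x v - D v))"
        by (auto simp: \<psi>'_def fun_eq_iff blinfun.bilinear_simps bounded_linear_Blinfun_apply bN bD
            linear_diff[OF bounded_linear.linear[OF bN]])
      ultimately show ?thesis by simp
    qed
    moreover have "continuous_on X \<psi>'"
      unfolding \<psi>'_def
      by (intro continuous_intros G'(2)
          bounded_bilinear.continuous_on[OF bounded_bilinear_blinfun_compose])
    ultimately show ?thesis unfolding C1_on_def by blast
  qed
  have \<psi>0: "\<psi> 0 = 0"
    by (simp add: \<psi>_def G(3) linear_0[OF linD] linear_0[OF bounded_linear.linear[OF bN]])
  \<comment> \<open>The correction \<open>N (G x - D x)\<close> has derivative
    \<open>N (D v - D v) = 0\<close> at 0.\<close>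
  have d\<psi>: "(\<psi> has_derivative id) (at 0)"
  proof -
    have "(\<psi> has_derivative (\<lambda>v. v + N (D v - D v))) (at 0)"
      unfolding \<psi>_def
      by (intro derivative_intros bounded_linear.has_derivative[OF bN] G(2)
          bounded_linear_imp_has_derivative bD)
    then show ?thesis
      by (simp add: linear_0[OF bounded_linear.linear[OF bN]] id_def)
  qed

  \<comment> \<open>Along the curve the equations hold exactly, whereas the inequalities and the
    decrease of \<open>h\<close> hold for all small positive \<open>t\<close> because they are
    strict to first order. One common \<open>t\<close> contradicts minimality.\<close>
  have strict: "h' u \<ge> 0"
    if u: "\<And>j. j \<in> J \<Longrightarrow> D u \<bullet> e j = 0" "\<And>i. i < l \<Longrightarrow> a i \<bullet> D u < 0" for u
  proof (rule ccontr)
    assume "\<not> h' u \<ge> 0"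
    then have hu: "h' u < 0" by simp
    obtain \<xi> \<delta> where \<xi>: "\<delta> > 0" "\<xi> 0 = 0" "(\<xi> has_vector_derivative u) (at 0 within {0..})"
      "\<And>t. 0 \<le> t \<Longrightarrow> t < \<delta> \<Longrightarrow> \<xi> t \<in> X \<and> \<psi> (\<xi> t) = t *\<^sub>R u"
      using right_inverse_curve[OF C1\<psi> X d\<psi> \<psi>0, of u] by metis
    have "\<forall>\<^sub>F t in at_right 0. \<forall>i\<in>{..<l}. a i \<bullet> G (\<xi> t) < a i \<bullet> G 0"
    proof (rule eventually_ball_finite, simp, safe)
      fix i assume "i < l"
      then show "\<forall>\<^sub>F t in at_right 0. a i \<bullet> G (\<xi> t) < a i \<bullet> G 0"
        using u(2) has_derivative_inner_right[OF G(2), of "a i"]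
        by (intro eventually_decreasing_along_curve[OF _ _ \<xi>(3,2)]) auto
    qed
    moreover have "\<forall>\<^sub>F t in at_right 0. h (\<xi> t) < h 0"
      by (rule eventually_decreasing_along_curve[OF h hu \<xi>(3,2)])
    moreover have "\<forall>\<^sub>F t in at_right 0. 0 < t \<and> t < \<delta>"
      using \<xi>(1) by (auto simp: eventually_at_right_field)
    ultimately have "\<forall>\<^sub>F t in at_right 0.
        (\<forall>i\<in>{..<l}. a i \<bullet> G (\<xi> t) < a i \<bullet> G 0) \<and> h (\<xi> t) < h 0 \<and> 0 < t \<and> t < \<delta>"
      by eventually_elim blast
    then obtain t :: real where t: "\<And>i. i < l \<Longrightarrow> a i \<bullet> G (\<xi> t) < 0" "h (\<xi> t) < h 0" "0 < t" "t < \<delta>"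
      using G(3) eventually_happens'[OF trivial_limit_at_right_real] by fastforce
    have \<xi>t: "\<xi> t \<in> X" "\<psi> (\<xi> t) = t *\<^sub>R u" using \<xi>(4)[of t] t by auto
    have "G (\<xi> t) \<bullet> e j = 0" if "j \<in> J" for j
    proof -
      \<comment> \<open>By \<open>DN\<close>, applying \<open>D\<close> to the correction replaces
        the \<open>J\<close>-coordinates of \<open>D (\<xi> t)\<close> by those of
        \<open>G (\<xi> t)\<close>.\<close>
      have "D (\<psi> (\<xi> t)) \<bullet> e j = G (\<xi> t) \<bullet> e j"
        by (simp add: \<psi>_def linear_add[OF linD] inner_add_left DN[OF that] inner_diff_left)
      then show ?thesis
        using u(1)[OF that] by (simp add: \<xi>t(2) linear_scale[OF linD])
    qed
    then have "G (\<xi> t) \<in> corner_cone e n k l A"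
      using t(1) by (auto simp: C less_imp_le)
    then show False using min[OF \<xi>t(1)] t(2) by simp
  qed

  have weak: "h' u \<ge> 0"
    if u: "\<And>j. j \<in> J \<Longrightarrow> D u \<bullet> e j = 0" "\<And>i. i < l \<Longrightarrow> a i \<bullet> D u \<le> 0" for u
  proof (rule ccontr)
    assume "\<not> h' u \<ge> 0"
    then have hu: "h' u < 0" by simp
    \<comment> \<open>Small enough that \<open>h' u + \<epsilon> * h' u0\<close> is still negative;
      the summand 1 prevents division by zero and makes the estimate strict.\<close>
    define \<epsilon> where "\<epsilon> = - h' u / (\<bar>h' u0\<bar> + 1)"
    have \<epsilon>: "\<epsilon> > 0" using hu by (simp add: \<epsilon>_def divide_neg_pos)
    have "h' (u + \<epsilon> *\<^sub>R u0) \<ge> 0"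
    proof (rule strict)
      show "D (u + \<epsilon> *\<^sub>R u0) \<bullet> e j = 0" if "j \<in> J" for j
        using u(1) u0(1) that
        by (simp add: linear_add[OF linD] linear_scale[OF linD] inner_add_left)
      show "a i \<bullet> D (u + \<epsilon> *\<^sub>R u0) < 0" if "i < l" for i
        using u(2)[OF that] u0(2)[OF that] \<epsilon>
        by (simp add: linear_add[OF linD] linear_scale[OF linD] inner_add_right
            add_nonpos_neg mult_pos_neg)
    qed
    moreover have "h' (u + \<epsilon> *\<^sub>R u0) = h' u + \<epsilon> * h' u0"
      by (simp add: linear_add[OF linh] linear_scale[OF linh])
    moreover have "\<epsilon> * h' u0 < \<epsilon> * (\<bar>h' u0\<bar> + 1)"
      using \<epsilon> by (intro mult_strict_left_mono) auto
    moreover have "\<epsilon> * (\<bar>h' u0\<bar> + 1) = - h' u"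
      by (simp add: \<epsilon>_def)
    ultimately show False by linarith
  qed

  text \<open>Each equation \<open>y \<bullet> e j = 0\<close> enters Farkas' lemma as a pair of inequalities.\<close>
  define b where "b i = (if i < l then a i else if i < l + n then
    (if i - l \<in> J then e (i - l) else 0) else (if i - l - n \<in> J then - e (i - l - n) else 0))" for i
  have b_cone: "b i \<bullet> y \<le> 0" if "y \<in> corner_cone e n k l A" for i y
    using that by (auto simp: b_def C inner_commute)
  have cone_b: "y \<in> corner_cone e n k l A" if "\<And>i. i < l + n + n \<Longrightarrow> b i \<bullet> y \<le> 0" for y
  proof -
    have "a i \<bullet> y \<le> 0" if "i < l" for i
      using \<open>\<And>i. i < l + n + n \<Longrightarrow> b i \<bullet> y \<le> 0\<close>[of i] that by (simp add: b_def)
    \<comment> \<open>The indices \<open>l + j\<close> and \<open>l + n + j\<close> carry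
      \<open>e j\<close> and its negative. Indices outside \<open>J\<close> carry the zero vector, a
      harmless padding of both blocks to length \<open>n\<close>.\<close>
    moreover have "y \<bullet> e j = 0" if "j \<in> J" for j
      using \<open>\<And>i. i < l + n + n \<Longrightarrow> b i \<bullet> y \<le> 0\<close>[of "l + j"]
        \<open>\<And>i. i < l + n + n \<Longrightarrow> b i \<bullet> y \<le> 0\<close>[of "l + n + j"] that
      by (simp add: b_def J_def inner_commute)
    ultimately show ?thesis by (simp add: C)
  qed
  \<comment> \<open>By \<open>weak\<close>, \<open>- h'\<close> is nonpositive wherever all
    functionals \<open>b i \<bullet> D u\<close> are, so Farkas applies; its coefficients weight the
    normals \<open>b i\<close> in the multiplier.\<close>
  have "\<exists>r. (\<forall>i<l + n + n. r i \<ge> 0) \<and> (\<forall>u. - h' u = (\<Sum>i<l + n + n. r i * (b i \<bullet> D u)))"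
  proof (rule farkas)
    show "linear (\<lambda>u. - h' u)" using linh by (rule linear_compose_neg)
    show "linear (\<lambda>u. b i \<bullet> D u)" for i
      by (rule linearI) (simp_all add: linear_add[OF linD] linear_scale[OF linD] inner_add_right)
    fix u assume "\<And>i. i < l + n + n \<Longrightarrow> b i \<bullet> D u \<le> 0"
    from cone_b[OF this] show "- h' u \<le> 0" using weak by (simp add: C)
  qed
  then obtain r where r: "\<And>i. i < l + n + n \<Longrightarrow> r i \<ge> 0"
    "\<And>u. - h' u = (\<Sum>i<l + n + n. r i * (b i \<bullet> D u))" by blast
  show ?thesis
  proof (intro exI[of _ "\<Sum>i<l + n + n. r i *\<^sub>R b i"] conjI allI ballI)
    show "h' u + (\<Sum>i<l + n + n. r i *\<^sub>R b i) \<bullet> D u = 0" for u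
      using r(2)[of u] by (simp add: inner_sum_left)
    show "(\<Sum>i<l + n + n. r i *\<^sub>R b i) \<bullet> c \<le> 0" if "c \<in> corner_cone e n k l A" for c
      using r(1) b_cone[OF that] by (auto simp: inner_sum_left intro!: sum_nonpos mult_nonneg_nonpos)
  qed
qed

section \<open>Charts and tangent vectors\<close>

lemma charts_atD:
  assumes "C2_manifold \<A>" "c \<in> charts_at \<A> p"
  shows "c \<in> \<A>" "is_chart c" "p \<in> fst c" "open (fst c)"
  using assms unfolding C2_manifold_def charts_at_def is_chart_def by auto

lemma chart_inv_apply: "is_chart c \<Longrightarrow> x \<in> fst c \<Longrightarrow> chart_inv c (snd c x) = x"
  unfolding is_chart_def by (blast intro: homeomorphism_apply1)

lemma continuous_on_chart: "is_chart c \<Longrightarrow> continuous_on (fst c) (snd c)"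
  unfolding is_chart_def by (blast dest: homeomorphism_cont1)

lemma open_chart_image:
  assumes c: "is_chart c" and W: "open W"
  shows "open (snd c ` (fst c \<inter> W))"
proof -
  have "openin (top_of_set (snd c ` fst c)) (snd c ` (fst c \<inter> W))"
    using c W unfolding is_chart_def
    by (meson homeomorphism_imp_open_map openin_open_Int)
  then show ?thesis
    using c openin_open_trans unfolding is_chart_def by blast
qed

lemma open_chart_vimage:
  assumes "is_chart c" "open W"
  shows "open (fst c \<inter> snd c -` W)"
  using assms continuous_on_chart continuous_on_open_vimage[of "fst c" "snd c"]
  unfolding is_chart_def by (metis Int_commute)

lemma some_chart_in:
  assumes "C2_manifold \<A>"
  shows "some_chart \<A> p \<in> charts_at \<A> p"
proof -
  have "p \<in> (\<Union>c\<in>\<A>. fst c)"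
    using assms unfolding C2_manifold_def by simp
  then have "\<exists>c. c \<in> charts_at \<A> p" unfolding charts_at_def by blast
  then show ?thesis unfolding some_chart_def by (rule someI_ex)
qed

lemma transition_has_derivative:
  assumes "C2_manifold \<A>" "c \<in> charts_at \<A> p" "d \<in> charts_at \<A> p"
  shows "((snd d \<circ> chart_inv c) has_derivative
    frechet_derivative (snd d \<circ> chart_inv c) (at (snd c p))) (at (snd c p))"
proof -
  have "C2_on (snd c ` (fst c \<inter> fst d)) (snd d \<circ> chart_inv c)"
    using assms unfolding C2_manifold_def charts_at_def C2_compatible_def by simp
  moreover have "snd c p \<in> snd c ` (fst c \<inter> fst d)"
    using assms by (simp add: charts_atD(3))
  ultimately show ?thesis by (intro C1_on_has_derivative[OF C2_on_imp_C1_on])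
qed

text \<open>Chain rule for coordinate changes; it makes a family built from one representative
  consistent across all charts.\<close>

lemma transition_cocycle:
  assumes \<A>: "C2_manifold \<A>"
    and c: "c \<in> charts_at \<A> p" and d: "d \<in> charts_at \<A> p" and e: "e \<in> charts_at \<A> p"
  shows "frechet_derivative (snd e \<circ> chart_inv d) (at (snd d p))
      (frechet_derivative (snd d \<circ> chart_inv c) (at (snd c p)) x) =
    frechet_derivative (snd e \<circ> chart_inv c) (at (snd c p)) x"
proof -
  note C = charts_atD[OF \<A> c] and D = charts_atD[OF \<A> d]
  have "((snd e \<circ> chart_inv d \<circ> (snd d \<circ> chart_inv c)) has_derivative
      frechet_derivative (snd e \<circ> chart_inv d) (at (snd d p)) \<circ>
      frechet_derivative (snd d \<circ> chart_inv c) (at (snd c p))) (at (snd c p))"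
    using transition_has_derivative[OF \<A> d e] C
    by (intro diff_chain_at transition_has_derivative[OF \<A> c d]) (simp add: chart_inv_apply)
  then have "((snd e \<circ> chart_inv c) has_derivative
      frechet_derivative (snd e \<circ> chart_inv d) (at (snd d p)) \<circ>
      frechet_derivative (snd d \<circ> chart_inv c) (at (snd c p))) (at (snd c p))"
    by (rule has_derivative_transform_within_open[of _ _ _ _ "snd c ` (fst c \<inter> fst d)"])
      (use C D in \<open>auto simp: chart_inv_apply intro: open_chart_image\<close>)
  from has_derivative_unique[OF this transition_has_derivative[OF \<A> c e]]
  show ?thesis by (metis comp_apply)
qed

lemma transition_refl:
  assumes \<A>: "C2_manifold \<A>" and c: "c \<in> charts_at \<A> p"
  shows "frechet_derivative (snd c \<circ> chart_inv c) (at (snd c p)) x = x"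
proof -
  note C = charts_atD[OF \<A> c]
  have "((snd c \<circ> chart_inv c) has_derivative (\<lambda>x. x)) (at (snd c p))"
    by (rule has_derivative_transform_within_open[of "\<lambda>x. x" _ _ _ "snd c ` fst c"])
      (use C in \<open>auto simp: chart_inv_apply is_chart_def[of c]\<close>)
  then show ?thesis
    using frechet_derivative_at by metis
qed

lemma tangent_space_chart:
  assumes "v \<in> tangent_space \<A> p" "c \<in> charts_at \<A> p" "d \<in> charts_at \<A> p"
  shows "v d = frechet_derivative (snd d \<circ> chart_inv c) (at (snd c p)) (v c)"
  using assms unfolding tangent_space_def by blast

lemma tangent_space_outside: "v \<in> tangent_space \<A> p \<Longrightarrow> c \<notin> charts_at \<A> p \<Longrightarrow> v c = 0"
  unfolding tangent_space_def by blast

lemma tangent_spaceI: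
  assumes "\<And>c. c \<notin> charts_at \<A> p \<Longrightarrow> v c = 0"
    and "\<And>c d. c \<in> charts_at \<A> p \<Longrightarrow> d \<in> charts_at \<A> p \<Longrightarrow>
      v d = frechet_derivative (snd d \<circ> chart_inv c) (at (snd c p)) (v c)"
  shows "v \<in> tangent_space \<A> p"
  using assms unfolding tangent_space_def by blast

lemma tangent_space_eqI:
  assumes "v \<in> tangent_space \<A> p" "w \<in> tangent_space \<A> p" "c \<in> charts_at \<A> p" "v c = w c"
  shows "v = w"
proof
  fix d show "v d = w d"
    using tangent_space_chart[OF assms(1,3), of d] tangent_space_chart[OF assms(2,3), of d]
      tangent_space_outside[OF assms(1), of d] tangent_space_outside[OF assms(2), of d] assms(4)
    by (cases "d \<in> charts_at \<A> p") simp_all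
qed

text \<open>Resolves the definite description: the cocycle rule makes this family a tangent vector,
  and one representative determines all others.\<close>

lemma tangent_vec_eq:
  assumes \<A>: "C2_manifold \<A>" and c: "c \<in> charts_at \<A> p"
  shows "tangent_vec \<A> p c x = (\<lambda>d. if d \<in> charts_at \<A> p
    then frechet_derivative (snd d \<circ> chart_inv c) (at (snd c p)) x else 0)" (is "_ = ?v")
proof -
  have v: "?v \<in> tangent_space \<A> p"
    by (rule tangent_spaceI) (simp_all add: transition_cocycle[OF \<A> c])
  have vc: "?v c = x" using c transition_refl[OF \<A> c] by simp
  show ?thesis
    unfolding tangent_vec_def
  proof (rule the_equality)
    show "?v \<in> tangent_space \<A> p \<and> ?v c = x" using v vc by blast
    fix w assume "w \<in> tangent_space \<A> p \<and> w c = x"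
    then show "w = ?v" using tangent_space_eqI[OF _ v c, of w] vc by simp
  qed
qed

lemma tangent_vec_in:
  assumes \<A>: "C2_manifold \<A>" and c: "c \<in> charts_at \<A> p"
  shows "tangent_vec \<A> p c x \<in> tangent_space \<A> p"
  unfolding tangent_vec_eq[OF assms]
  by (rule tangent_spaceI) (simp_all add: transition_cocycle[OF \<A> c])

lemma tangent_vec_apply:
  assumes \<A>: "C2_manifold \<A>" and c: "c \<in> charts_at \<A> p"
  shows "tangent_vec \<A> p c x c = x"
  unfolding tangent_vec_eq[OF assms] using c transition_refl[OF \<A> c] by simp

lemma tangent_vec_inverse:
  assumes "C2_manifold \<A>" "c \<in> charts_at \<A> p" "v \<in> tangent_space \<A> p"
  shows "tangent_vec \<A> p c (v c) = v"
  using assms tangent_space_eqI tangent_vec_in tangent_vec_apply by metis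

text \<open>Tangent vectors carry the product topology, so continuity is checked chart by chart,
  where each component is bounded linear or zero.\<close>

lemma continuous_on_tangent_vec:
  assumes \<A>: "C2_manifold \<A>" and c: "c \<in> charts_at \<A> p"
  shows "continuous_on UNIV (tangent_vec \<A> p c)"
proof (rule continuous_on_coordinatewise_then_product)
  fix d show "continuous_on UNIV (\<lambda>x. tangent_vec \<A> p c x d)"
    using has_derivative_bounded_linear[OF transition_has_derivative[OF \<A> c, of d]]
    by (cases "d \<in> charts_at \<A> p")
      (simp_all add: tangent_vec_eq[OF assms] linear_continuous_on)
qed

lemma zero_in_tangent_space:
  assumes \<A>: "C2_manifold \<A>"
  shows "0 \<in> tangent_space \<A> p"
  by (rule tangent_spaceI)
    (simp_all add: linear_0[OF has_derivative_linear[OF transition_has_derivative[OF \<A>]]])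

lemma scaleR_in_tangent_space:
  assumes \<A>: "C2_manifold \<A>" and v: "v \<in> tangent_space \<A> p"
  shows "r *\<^sub>R v \<in> tangent_space \<A> p"
proof (rule tangent_spaceI)
  fix c assume "c \<notin> charts_at \<A> p"
  then show "(r *\<^sub>R v) c = 0" by (simp add: scaleR_fun_def tangent_space_outside[OF v])
next
  fix c d assume cd: "c \<in> charts_at \<A> p" "d \<in> charts_at \<A> p"
  show "(r *\<^sub>R v) d = frechet_derivative (snd d \<circ> chart_inv c) (at (snd c p)) ((r *\<^sub>R v) c)"
    using tangent_space_chart[OF v cd]
    by (simp add: scaleR_fun_def
        linear_scale[OF has_derivative_linear[OF transition_has_derivative[OF \<A> cd]]])
qed

lemma tangent_vec_0:
  assumes "C2_manifold \<A>" "c \<in> charts_at \<A> p"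
  shows "tangent_vec \<A> p c 0 = 0"
  using tangent_vec_inverse[OF assms zero_in_tangent_space[OF assms(1)]] by simp

text \<open>\<open>V\<close> is only relatively open, but \<open>tangent_vec\<close> takes values in
  the tangent space, so an open extension of \<open>V\<close> has the same preimage.\<close>

lemma open_tangent_vec_vimage:
  assumes \<A>: "C2_manifold \<A>" and c: "c \<in> charts_at \<A> p"
    and V: "openin (top_of_set (tangent_space \<A> p)) V"
  shows "open (tangent_vec \<A> p c -` V)"
proof -
  obtain V' where V': "open V'" "V = tangent_space \<A> p \<inter> V'"
    using V by (auto simp: openin_open)
  then have "tangent_vec \<A> p c -` V = tangent_vec \<A> p c -` V'"
    using tangent_vec_in[OF \<A> c] by auto
  then show ?thesis
    using open_vimage[OF V'(1) continuous_on_tangent_vec[OF \<A> c]] by simp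
qed

section \<open>Retractions, linearizing maps and the tangent cone\<close>

text \<open>\<open>Q\<close> may be smaller than the chart domain, so that it can later be cut down
  to points which \<open>g\<close> maps into a given chart of the target.\<close>

lemma retraction_chart:
  assumes \<A>: "C2_manifold \<A>" and c: "c \<in> charts_at \<A> p" and R: "local_retraction \<A> p V R"
    and Q: "open Q" "p \<in> Q" "Q \<subseteq> fst d" and d: "d \<in> \<A>"
  defines "X \<equiv> {x. tangent_vec \<A> p c x \<in> V \<and> R (tangent_vec \<A> p c x) \<in> Q}"
  shows "open X" "0 \<in> X" "C1_on X (snd d \<circ> R \<circ> tangent_vec \<A> p c)"
proof -
  have V: "openin (top_of_set (tangent_space \<A> p)) V" "0 \<in> V" "continuous_on V R" "R 0 = p"
    using R unfolding local_retraction_def by auto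
  have "continuous_on (tangent_vec \<A> p c -` V) (R \<circ> tangent_vec \<A> p c)"
    by (intro continuous_on_compose continuous_on_subset[OF continuous_on_tangent_vec[OF \<A> c]]
        continuous_on_subset[OF V(3)]) auto
  from continuous_on_open_vimage[THEN iffD1, rule_format, OF open_tangent_vec_vimage[OF \<A> c V(1)] this Q(1)]
  show "open X" by (rule back_subst[where P = "open"]) (auto simp: X_def)
  show "0 \<in> X" using V Q by (simp add: X_def tangent_vec_0[OF \<A> c])
  have "C2_on {x. tangent_vec \<A> p c x \<in> V \<and> R (tangent_vec \<A> p c x) \<in> fst d}
          (snd d \<circ> R \<circ> tangent_vec \<A> p c)"
    using R c d unfolding local_retraction_def by blast
  then show "C1_on X (snd d \<circ> R \<circ> tangent_vec \<A> p c)"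
    using Q(3) by (intro C1_on_subset[OF C2_on_imp_C1_on]) (auto simp: X_def)
qed

text \<open>\<open>local_right_inverse\<close> is applied to the chart representative of
  \<open>R\<close> on a domain already restricted to \<open>W\<close>; injectivity of the chart
  turns equal coordinates into equal points.\<close>

lemma retraction_covers_neighbourhood:
  fixes \<A> :: "('p::{t2_space, second_countable_topology}, 'e::{real_inner, heine_borel}) chart set"
  assumes \<A>: "C2_manifold \<A>" and R: "local_retraction \<A> p V R" and W: "open W" "0 \<in> W"
  shows "\<exists>W'. open W' \<and> p \<in> W' \<and> W' \<subseteq> R ` (V \<inter> W)"
proof -
  define c where "c = some_chart \<A> p"
  have c: "c \<in> charts_at \<A> p" unfolding c_def by (rule some_chart_in[OF \<A>])
  note C = charts_atD[OF \<A> c]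
  define T where "T = tangent_vec \<A> p c"
  define X where "X = {x. T x \<in> V \<and> R (T x) \<in> fst c}"
  note X = retraction_chart[OF \<A> c R C(4,3) subset_refl C(1), folded T_def, folded X_def]
  have R0: "R 0 = p" and dR: "((snd c \<circ> R \<circ> T) has_derivative id) (at 0)"
    using R c unfolding local_retraction_def T_def by auto
  have T0: "T 0 = 0" unfolding T_def by (rule tangent_vec_0[OF \<A> c])
  have "open (X \<inter> T -` W)"
    using X(1) open_vimage[OF W(1) continuous_on_tangent_vec[OF \<A> c]] by (auto simp: T_def)
  moreover have "0 \<in> X \<inter> T -` W" using X(2) W(2) T0 by simp
  ultimately obtain \<delta> where \<delta>: "\<delta> > 0" "\<And>y. norm (y - snd c p) < \<delta> \<Longrightarrow>
      \<exists>x\<in>X \<inter> T -` W. snd c (R (T x)) = y"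
    using local_right_inverse[OF C1_on_subset[OF X(3)] _ _ dR, of "X \<inter> T -` W"] T0 R0
    by auto metis
  have "fst c \<inter> snd c -` ball (snd c p) \<delta> \<subseteq> R ` (V \<inter> W)"
  proof clarify
    fix y assume y: "y \<in> fst c" "snd c y \<in> ball (snd c p) \<delta>"
    then obtain x where x: "x \<in> X" "T x \<in> W" "snd c (R (T x)) = snd c y"
      using \<delta>(2)[of "snd c y"] by (auto simp: dist_norm norm_minus_commute)
    then have "R (T x) = y"
      using y(1) chart_inv_apply[OF C(2)] unfolding X_def by (metis (mono_tags) mem_Collect_eq)
    then show "y \<in> R ` (V \<inter> W)" using x X_def by blast
  qed
  then show ?thesis
    using open_chart_vimage[OF C(2), of "ball (snd c p) \<delta>"] C(3) \<delta>(1)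
    by (intro exI[of _ "fst c \<inter> snd c -` ball (snd c p) \<delta>"]) auto
qed

text \<open>The same inversion for \<open>S\<close>, with smallness measured in the chart
  \<open>c\<close>; a preimage of \<open>w c\<close> is a preimage of \<open>w\<close> because one
  representative determines the vector.\<close>

lemma linearizing_map_covers_neighbourhood:
  fixes \<B> :: "('q::{t2_space, second_countable_topology}, 'f::{real_inner, heine_borel}) chart set"
  assumes \<B>: "C2_manifold \<B>" and S: "local_linearizing_map \<B> q U S" and c: "c \<in> charts_at \<B> q"
  shows "\<exists>\<delta>>0. \<forall>w\<in>tangent_space \<B> q. norm (w c) < \<delta> \<longrightarrow> w \<in> S ` U"
proof -
  note C = charts_atD[OF \<B> c]
  have U: "open U" "q \<in> U" "S ` U \<subseteq> tangent_space \<B> q" "S q = 0"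
    "C2_fun_on \<B> U (\<lambda>y. S y c)"
    "(((\<lambda>y. S y c) \<circ> chart_inv c) has_derivative id) (at (snd c q))"
    using S c unfolding local_linearizing_map_def by auto
  have "C1_on (snd c ` (fst c \<inter> U)) ((\<lambda>y. S y c) \<circ> chart_inv c)"
    using U(5) C(1) unfolding C2_fun_on_def by (simp add: C2_on_imp_C1_on)
  from local_right_inverse[OF this open_chart_image[OF C(2) U(1)] _ U(6)]
  obtain \<delta> where \<delta>: "\<delta> > 0" "\<And>y. norm y < \<delta> \<Longrightarrow>
      \<exists>x\<in>snd c ` (fst c \<inter> U). S (chart_inv c x) c = y"
    using C U(2,4) by (auto simp: chart_inv_apply)
  show ?thesis
  proof (intro exI[of _ \<delta>] conjI ballI impI \<delta>(1))
    fix w assume w: "w \<in> tangent_space \<B> q" "norm (w c) < \<delta>"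
    then obtain y where y: "y \<in> fst c" "y \<in> U" "S y c = w c"
      using \<delta>(2)[OF w(2)] C(2) by (auto simp: chart_inv_apply)
    then have "S y = w" using tangent_space_eqI[OF _ w(1) c, of "S y"] U(3) by blast
    then show "w \<in> S ` U" using y by blast
  qed
qed

section \<open>The polyhedral cone and the tangent cone of its germ\<close>

text \<open>Unpacks the choice in the definition of the cone and fixes the chosen adapted chart, in
  which the cone is polyhedral.\<close>

lemma inner_tangent_cone_adapted:
  assumes K: "submanifold_with_corners \<B> e n k K" and q: "q \<in> K"
  obtains c l A where "adapted_chart \<B> e n k K q c l A"
    "inner_tangent_cone \<B> e n k K q = {v \<in> tangent_space \<B> q. v c \<in> corner_cone e n k l A}"
proof -
  obtain c l A where cla: "(SOME (c, l, A). adapted_chart \<B> e n k K q c l A) = (c, l, A)"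
    by (metis prod_cases3)
  have "\<exists>x. (case x of (c, l, A) \<Rightarrow> adapted_chart \<B> e n k K q c l A)"
    using K q unfolding submanifold_with_corners_def by auto
  from someI_ex[OF this] have "adapted_chart \<B> e n k K q c l A" unfolding cla by simp
  then show ?thesis
    using that cla unfolding inner_tangent_cone_def by (simp add: Let_def)
qed

lemma corner_cone_scaleR:
  assumes "x \<in> corner_cone e n k l A" "r \<ge> 0"
  shows "r *\<^sub>R x \<in> corner_cone e n k l A"
proof -
  have "(\<Sum>j<n. A i j * (r *\<^sub>R x \<bullet> e j)) = r * (\<Sum>j<n. A i j * (x \<bullet> e j))" for i
    by (simp add: sum_distrib_left mult.left_commute)
  then show ?thesis
    using assms unfolding corner_cone_def by (auto simp: mult_nonneg_nonpos)
qed

lemma closed_corner_cone: "closed (corner_cone e n k l A)"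
proof -
  have "corner_cone e n k l A =
      (\<Inter>j\<in>{k..<n}. {x. x \<bullet> e j = 0}) \<inter> (\<Inter>i<l. {x. (\<Sum>j<n. A i j * (x \<bullet> e j)) \<le> 0})"
    unfolding corner_cone_def by auto
  then show ?thesis
    by (simp only:) (intro closed_Int closed_INT ballI closed_Collect_eq closed_Collect_le continuous_intros)
qed

text \<open>\<open>Q\<close> contains all small tangent vectors. A limit of rescaled points stays in
  the closed cone; conversely, each \<open>v\<close> in the cone is reached by the constant sequence
  \<open>v\<close> with small step sizes.\<close>

lemma tangent_cone_conic_germ:
  assumes \<B>: "C2_manifold \<B>" and c: "c \<in> charts_at \<B> q"
    and Q: "\<delta> > 0" "\<And>w. w \<in> tangent_space \<B> q \<Longrightarrow> norm (w c) < \<delta> \<Longrightarrow> w \<in> Q"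
    and C_def: "C = {v \<in> tangent_space \<B> q. v c \<in> corner_cone e n k l A}"
  shows "tangent_cone_0 (tangent_space \<B> q) (Q \<inter> C) = C"
proof (intro equalityI subsetI)
  fix v assume "v \<in> tangent_cone_0 (tangent_space \<B> q) (Q \<inter> C)"
  then obtain t x where v: "v \<in> tangent_space \<B> q" and t: "\<And>j :: nat. t j > (0 :: real)"
    and x: "x \<longlonglongrightarrow> v" "\<And>j. t j *\<^sub>R x j \<in> C"
    unfolding tangent_cone_0_def by blast
  have "x j c \<in> corner_cone e n k l A" for j
  proof -
    have "t j *\<^sub>R x j c \<in> corner_cone e n k l A"
      using x(2)[of j] by (simp add: C_def scaleR_fun_def)
    from corner_cone_scaleR[OF this, of "inverse (t j)"] t[of j] show ?thesis
      by simp
  qed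
  moreover have "(\<lambda>j. x j c) \<longlonglongrightarrow> v c"
    using continuous_on_tendsto_compose[OF continuous_on_product_coordinates x(1)] by simp
  ultimately have "v c \<in> corner_cone e n k l A"
    by (meson closed_corner_cone closed_sequentially)
  then show "v \<in> C" using v by (simp add: C_def)
next
  fix v assume v: "v \<in> C"
  \<comment> \<open>Keeps the representative of \<open>r *\<^sub>R v\<close> below
    \<open>\<delta>\<close>, also if \<open>v c = 0\<close>; the steps below are r/(j+1), hence
    never exceed \<open>r\<close>.\<close>
  define r where "r = \<delta> / (norm (v c) + 1)"
  have r: "r > 0" "r * (norm (v c) + 1) = \<delta>"
    using Q(1) norm_ge_zero[of "v c"] by (simp_all add: r_def add_nonneg_pos add_nonneg_eq_0_iff)
  define t where "t j = r * inverse (real (Suc j))" for j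
  have t0: "t j > 0" for j using r(1) by (simp add: t_def)
  have "decseq t"
    unfolding t_def decseq_def using r(1)
    by (auto intro!: mult_left_mono le_imp_inverse_le)
  moreover have "t \<longlonglongrightarrow> 0"
    unfolding t_def by (rule LIMSEQ_inverse_real_of_nat [THEN tendsto_mult_right_zero])
  moreover have "t j *\<^sub>R v \<in> Q \<inter> C" for j
  proof -
    have vT: "t j *\<^sub>R v \<in> tangent_space \<B> q"
      using v by (auto simp: C_def intro: scaleR_in_tangent_space[OF \<B>])
    have "t j \<le> r"
      unfolding t_def using r(1) by (intro mult_left_le) (auto simp: inverse_le_1_iff)
    then have "t j * norm (v c) \<le> r * norm (v c)"
      by (intro mult_right_mono) auto
    also have "\<dots> < r * (norm (v c) + 1)"
      using r(1) by (intro mult_strict_left_mono) auto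
    also note r(2)
    finally have "norm ((t j *\<^sub>R v) c) < \<delta>"
      using t0[of j] by (simp add: scaleR_fun_def)
    then show ?thesis
      using Q(2)[OF vT] vT v t0[of j]
      by (auto simp: C_def scaleR_fun_def intro: corner_cone_scaleR)
  qed
  ultimately show "v \<in> tangent_cone_0 (tangent_space \<B> q) (Q \<inter> C)"
    using v t0 unfolding tangent_cone_0_def C_def
    by (auto intro!: exI[of _ t] exI[of _ "\<lambda>_. v"])
qed

section \<open>Transport of minimality and derivatives to the tangent spaces\<close>

text \<open>Forward by continuity of \<open>R\<close>, backward because \<open>R\<close> maps
  neighbourhoods of 0 onto sets containing a neighbourhood of \<open>p\<close>.\<close>

lemma local_minimizer_pullback:
  fixes \<A> :: "('p::{t2_space, second_countable_topology}, 'e::{real_inner, heine_borel}) chart set"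
  assumes \<A>: "C2_manifold \<A>" and R: "local_retraction \<A> p V R"
  shows "local_minimizer f F p \<longleftrightarrow> local_minimizer (f \<circ> R) {v \<in> V. R v \<in> F} 0"
proof
  have V: "openin (top_of_set (tangent_space \<A> p)) V" "0 \<in> V" "continuous_on V R" "R 0 = p"
    using R unfolding local_retraction_def by auto
  {
    assume "local_minimizer f F p"
    then obtain W where W: "p \<in> F" "open W" "p \<in> W" "\<And>y. y \<in> F \<Longrightarrow> y \<in> W \<Longrightarrow> f p \<le> f y"
      unfolding local_minimizer_def by blast
    obtain W' where W': "open W'" "W' \<inter> V = R -` W \<inter> V"
      using V(3) W(2) unfolding continuous_on_open_invariant by blast
    have "\<forall>v\<in>{v \<in> V. R v \<in> F} \<inter> W'. (f \<circ> R) 0 \<le> (f \<circ> R) v"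
      using W'(2) W(4) V(4) by auto
    moreover have "0 \<in> W'" using W'(2) V(2,4) W(3) by blast
    ultimately show "local_minimizer (f \<circ> R) {v \<in> V. R v \<in> F} 0"
      using W'(1) W(1) V(2,4) unfolding local_minimizer_def by blast
  next
    assume "local_minimizer (f \<circ> R) {v \<in> V. R v \<in> F} 0"
    then obtain W where W: "p \<in> F" "open W" "0 \<in> W"
      "\<And>v. v \<in> V \<Longrightarrow> R v \<in> F \<Longrightarrow> v \<in> W \<Longrightarrow> f p \<le> f (R v)"
      using V(4) unfolding local_minimizer_def by auto
    obtain W' where "open W'" "p \<in> W'" "W' \<subseteq> R ` (V \<inter> W)"
      using retraction_covers_neighbourhood[OF \<A> R W(2,3)] by blast
    then show "local_minimizer f F p"
      using W(1,4) unfolding local_minimizer_def by blast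
  }
qed

text \<open>In charts the map is a composite of three representatives. Those of \<open>R\<close> and
  \<open>S\<close> have identity derivative at the base points, so only the derivative of
  \<open>g\<close> remains.\<close>

lemma linearized_map_C1:
  fixes \<A> :: "('p::{t2_space, second_countable_topology}, 'e::{real_inner, heine_borel}) chart set"
    and \<B> :: "('q::{t2_space, second_countable_topology}, 'f::{real_inner, heine_borel}) chart set"
  assumes \<A>: "C2_manifold \<A>" and \<B>: "C2_manifold \<B>" and g: "C2_map \<A> \<B> g"
    and R: "local_retraction \<A> p V R" and S: "local_linearizing_map \<B> (g p) U S"
    and gRV: "g ` R ` V \<subseteq> U"
    and c: "c \<in> charts_at \<A> p" and d: "d \<in> charts_at \<B> (g p)"
  shows "\<exists>X. open X \<and> 0 \<in> X \<and> tangent_vec \<A> p c ` X \<subseteq> V \<and>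
      C1_on X (\<lambda>x. S (g (R (tangent_vec \<A> p c x))) d)" (is ?C1)
    and "((\<lambda>x. S (g (R (tangent_vec \<A> p c x))) d) has_derivative
      frechet_derivative (snd d \<circ> g \<circ> chart_inv c) (at (snd c p))) (at 0)" (is ?deriv)
proof -
  note C = charts_atD[OF \<A> c] and D = charts_atD[OF \<B> d]
  define T where "T = tangent_vec \<A> p c"
  define Q where "Q = fst c \<inter> g -` fst d"
  define X where "X = {x. T x \<in> V \<and> R (T x) \<in> Q}"
  have R0: "R 0 = p" and dR: "((snd c \<circ> R \<circ> T) has_derivative id) (at 0)"
    using R c unfolding local_retraction_def T_def by auto
  have T0: "T 0 = 0" unfolding T_def by (rule tangent_vec_0[OF \<A> c])
  have U: "open U" "g p \<in> U" "C2_fun_on \<B> U (\<lambda>y. S y d)"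
    "(((\<lambda>y. S y d) \<circ> chart_inv d) has_derivative id) (at (snd d (g p)))"
    using S d unfolding local_linearizing_map_def by auto
  have "open Q"
    using g unfolding Q_def C2_map_def by (intro open_Int C(4) open_vimage[OF D(4)]) simp
  from retraction_chart[OF \<A> c R this _ _ C(1), folded T_def, folded X_def]
  have X: "open X" "0 \<in> X" "C1_on X (snd c \<circ> R \<circ> T)"
    using C(3) D(3) by (auto simp: Q_def)
  have cg: "C1_on (snd c ` Q) (snd d \<circ> g \<circ> chart_inv c)"
    using g C(1) D(1) unfolding C2_map_def Q_def by (blast intro: C2_on_imp_C1_on)
  have cS: "C1_on (snd d ` (fst d \<inter> U)) ((\<lambda>y. S y d) \<circ> chart_inv d)"
    using U(3) D(1) unfolding C2_fun_on_def by (blast intro: C2_on_imp_C1_on)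
  \<comment> \<open>Chart inverses cancel only on \<open>X\<close>, so both claims are transferred
    from \<open>?h\<close> through agreement on this open set.\<close>
  let ?h = "((\<lambda>y. S y d) \<circ> chart_inv d) \<circ> ((snd d \<circ> g \<circ> chart_inv c) \<circ> (snd c \<circ> R \<circ> T))"
  have h_eq: "?h x = S (g (R (T x))) d" if "x \<in> X" for x
    using that C(2) D(2) by (simp add: X_def Q_def chart_inv_apply)
  have "C1_on X ?h"
  proof (rule C1_on_compose[OF C1_on_compose[OF X(3) cg] cS])
    show "(snd c \<circ> R \<circ> T) ` X \<subseteq> snd c ` Q" by (auto simp: X_def)
    show "((snd d \<circ> g \<circ> chart_inv c) \<circ> (snd c \<circ> R \<circ> T)) ` X \<subseteq> snd d ` (fst d \<inter> U)"
      using gRV C(2) by (auto simp: X_def Q_def chart_inv_apply)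
  qed
  from C1_on_cong[OF this X(1) h_eq] show ?C1
    using X(1,2) unfolding T_def[symmetric] by (intro exI[of _ X]) (auto simp: X_def)
  have dg: "((snd d \<circ> g \<circ> chart_inv c) has_derivative
      frechet_derivative (snd d \<circ> g \<circ> chart_inv c) (at (snd c p))) (at (snd c p))"
    using C(3) D(3) by (intro C1_on_has_derivative[OF cg]) (simp add: Q_def)
  have "(?h has_derivative id \<circ> (frechet_derivative (snd d \<circ> g \<circ> chart_inv c) (at (snd c p)) \<circ> id))
      (at 0)"
    using U(4) dg C R0 T0 by (intro diff_chain_at dR) (simp_all add: chart_inv_apply)
  then show ?deriv
    unfolding T_def[symmetric] id_o o_id
    by (rule has_derivative_transform_within_open[OF _ X(1,2) h_eq])
qed

lemma pullback_fun_has_derivative: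
  fixes \<A> :: "('p::{t2_space, second_countable_topology}, 'e::{real_inner, heine_borel}) chart set"
  assumes \<A>: "C2_manifold \<A>" and f: "C2_fun_on \<A> UNIV f"
    and R: "local_retraction \<A> p V R" and c: "c \<in> charts_at \<A> p"
  shows "((\<lambda>x. f (R (tangent_vec \<A> p c x))) has_derivative
    frechet_derivative (\<lambda>x. f (R (tangent_vec \<A> p c x))) (at 0)) (at 0)"
proof -
  note C = charts_atD[OF \<A> c]
  define T where "T = tangent_vec \<A> p c"
  define X where "X = {x. T x \<in> V \<and> R (T x) \<in> fst c}"
  note X = retraction_chart[OF \<A> c R C(4,3) subset_refl C(1), folded T_def, folded X_def]
  have cf: "C1_on (snd c ` fst c) (f \<circ> chart_inv c)"
    using f C(1) unfolding C2_fun_on_def by (auto intro: C2_on_imp_C1_on)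
  have "C1_on X ((f \<circ> chart_inv c) \<circ> (snd c \<circ> R \<circ> T))"
    by (rule C1_on_compose[OF X(3) cf]) (auto simp: X_def)
  then have "C1_on X (\<lambda>x. f (R (T x)))"
    by (rule C1_on_cong[OF _ X(1)]) (use C(2) in \<open>auto simp: X_def chart_inv_apply\<close>)
  from C1_on_has_derivative[OF this X(2)] show ?thesis by (simp add: T_def)
qed

lemma tangent_map_deriv_eq:
  fixes \<A> :: "('p::{t2_space, second_countable_topology}, 'e::{real_inner, heine_borel}) chart set"
    and \<B> :: "('q::{t2_space, second_countable_topology}, 'f::{real_inner, heine_borel}) chart set"
  assumes \<A>: "C2_manifold \<A>" and \<B>: "C2_manifold \<B>" and g: "C2_map \<A> \<B> g"
    and R: "local_retraction \<A> p V R" and S: "local_linearizing_map \<B> (g p) U S"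
    and gRV: "g ` R ` V \<subseteq> U"
  shows "tangent_map_deriv \<A> p \<B> (g p) (S \<circ> g \<circ> R) v = map_deriv \<A> \<B> g p v"
  using frechet_derivative_at[OF linearized_map_C1(2)[OF assms some_chart_in[OF \<A>] some_chart_in[OF \<B>]]]
  unfolding tangent_map_deriv_def map_deriv_def by (simp add: Let_def)

text \<open>\<open>map_deriv\<close> uses an arbitrarily chosen target chart, whereas the cone is
  described in an adapted one; the chain rule with the transition map links them.\<close>

lemma map_deriv_chart:
  fixes \<A> :: "('p::{t2_space, second_countable_topology}, 'e::{real_inner, heine_borel}) chart set"
    and \<B> :: "('q::{t2_space, second_countable_topology}, 'f::{real_inner, heine_borel}) chart set"
  assumes \<A>: "C2_manifold \<A>" and \<B>: "C2_manifold \<B>" and g: "C2_map \<A> \<B> g"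
    and d: "d \<in> charts_at \<B> (g p)"
  defines "c \<equiv> some_chart \<A> p"
  shows "map_deriv \<A> \<B> g p v d =
    frechet_derivative (snd d \<circ> g \<circ> chart_inv c) (at (snd c p)) (v c)"
proof -
  define d' where "d' = some_chart \<B> (g p)"
  have c: "c \<in> charts_at \<A> p" unfolding c_def by (rule some_chart_in[OF \<A>])
  have d': "d' \<in> charts_at \<B> (g p)" unfolding d'_def by (rule some_chart_in[OF \<B>])
  note C = charts_atD[OF \<A> c] and D = charts_atD[OF \<B> d] and D' = charts_atD[OF \<B> d']
  have dg: "((snd e \<circ> g \<circ> chart_inv c) has_derivative
      frechet_derivative (snd e \<circ> g \<circ> chart_inv c) (at (snd c p))) (at (snd c p))"
    if e: "e \<in> charts_at \<B> (g p)" for e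
  proof (rule C1_on_has_derivative[OF C2_on_imp_C1_on])
    show "C2_on (snd c ` (fst c \<inter> g -` fst e)) (snd e \<circ> g \<circ> chart_inv c)"
      using g C(1) charts_atD(1)[OF \<B> e] unfolding C2_map_def by blast
    show "snd c p \<in> snd c ` (fst c \<inter> g -` fst e)"
      using C(3) charts_atD(3)[OF \<B> e] by simp
  qed
  let ?P = "frechet_derivative (snd d \<circ> chart_inv d') (at (snd d' (g p)))"
  have "((snd d \<circ> chart_inv d') \<circ> (snd d' \<circ> g \<circ> chart_inv c) has_derivative
      ?P \<circ> frechet_derivative (snd d' \<circ> g \<circ> chart_inv c) (at (snd c p))) (at (snd c p))"
    using transition_has_derivative[OF \<B> d' d] C
    by (intro diff_chain_at dg d') (simp add: chart_inv_apply)
  moreover have "open (snd c ` (fst c \<inter> g -` fst d'))"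
    using g unfolding C2_map_def by (intro open_chart_image[OF C(2)] open_vimage[OF D'(4)]) simp
  ultimately have "((snd d \<circ> g \<circ> chart_inv c) has_derivative
      ?P \<circ> frechet_derivative (snd d' \<circ> g \<circ> chart_inv c) (at (snd c p))) (at (snd c p))"
    by (rule has_derivative_transform_within_open)
      (use C D' in \<open>auto simp: chart_inv_apply\<close>)
  from has_derivative_unique[OF this dg[OF d]]
  have "?P (frechet_derivative (snd d' \<circ> g \<circ> chart_inv c) (at (snd c p)) (v c)) =
      frechet_derivative (snd d \<circ> g \<circ> chart_inv c) (at (snd c p)) (v c)"
    by (simp add: fun_eq_iff)
  then show ?thesis
    using d unfolding map_deriv_def Let_def c_def[symmetric] d'_def[symmetric]
      tangent_vec_eq[OF \<B> d'] by simp
qed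

theorem theorem5p3:
  fixes \<A> :: "('p::{t2_space, second_countable_topology}, 'e::{real_inner, heine_borel}) chart set"
    and \<B> :: "('q::{t2_space, second_countable_topology}, 'f::{real_inner, heine_borel}) chart set"
    and m n k :: nat
    and eM :: "nat \<Rightarrow> 'e" and eN :: "nat \<Rightarrow> 'f"
    and K :: "'q set"
    and f :: "'p \<Rightarrow> real" and g :: "'p \<Rightarrow> 'q"
    and F :: "'p set" and p :: 'p
    and V :: "('p, 'e) tangent set" and R :: "('p, 'e) tangent \<Rightarrow> 'p"
    and U :: "'q set" and S :: "'q \<Rightarrow> ('q, 'f) tangent"
    and fbar :: "('p, 'e) tangent \<Rightarrow> real"
    and gbar :: "('p, 'e) tangent \<Rightarrow> ('q, 'f) tangent"
    and Kbar :: "('q, 'f) tangent set"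
  assumes "coordinate_basis m eM" and "C2_manifold \<A>"
    and "coordinate_basis n eN" and "C2_manifold \<B>"
    and "submanifold_with_corners \<B> eN n k K"
    and "C2_fun_on \<A> UNIV f" and "C2_map \<A> \<B> g"
    and F_eq: "F = {x. g x \<in> K}"
    and "p \<in> F"
    and "local_retraction \<A> p V R"
    and "adapted_linearizing_map \<B> eN n k K (g p) U S"
    and "inj_on R V" and "inj_on S U"
    and "g ` R ` V \<subseteq> U"
    and fbar_eq: "fbar = f \<circ> R"
    and gbar_eq: "gbar = S \<circ> g \<circ> R"
    and Kbar_eq: "Kbar = S ` (K \<inter> U)"
  shows "(local_minimizer f F p \<longleftrightarrow> local_minimizer fbar {v \<in> V. gbar v \<in> Kbar} 0) \<and>
    (local_minimizer f F p \<and>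
     {a - b | a b. a \<in> map_deriv \<A> \<B> g p ` tangent_space \<A> p \<and>
                   b \<in> inner_tangent_cone \<B> eN n k K (g p)} = tangent_space \<B> (g p) \<longrightarrow>
     (\<exists>\<mu>\<in>cotangent_space \<B> (g p).
        (\<forall>v\<in>tangent_space \<A> p.
           tangent_fun_deriv \<A> p fbar v + \<mu> (tangent_map_deriv \<A> p \<B> (g p) gbar v) = 0) \<and>
        \<mu> \<in> polar_cone \<B> (g p) (tangent_cone_0 (tangent_space \<B> (g p)) Kbar) \<and>
        polar_cone \<B> (g p) (tangent_cone_0 (tangent_space \<B> (g p)) Kbar) =
          polar_cone \<B> (g p) (inner_tangent_cone \<B> eN n k K (g p))))"
proof -
  note \<A> = \<open>C2_manifold \<A>\<close> and \<B> = \<open>C2_manifold \<B>\<close> and R = \<open>local_retraction \<A> p V R\<close>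
    and g = \<open>C2_map \<A> \<B> g\<close> and f = \<open>C2_fun_on \<A> UNIV f\<close> and gRV = \<open>g ` R ` V \<subseteq> U\<close>
  define Ti where "Ti = inner_tangent_cone \<B> eN n k K (g p)"
  have S: "local_linearizing_map \<B> (g p) U S" and SK: "S ` (U \<inter> K) = S ` U \<inter> Ti"
    using \<open>adapted_linearizing_map \<B> eN n k K (g p) U S\<close>
    unfolding adapted_linearizing_map_def Ti_def by auto
  have ST: "S ` U \<subseteq> tangent_space \<B> (g p)" "S (g p) = 0"
    using S unfolding local_linearizing_map_def by auto
  \<comment> \<open>Injectivity of \<open>S\<close> on \<open>U\<close> lets membership in
    \<open>Kbar\<close> be tested before applying \<open>S\<close>.\<close>
  have feasible: "{v \<in> V. gbar v \<in> Kbar} = {v \<in> V. R v \<in> F}"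
  proof (intro Collect_cong conj_cong refl)
    fix v assume "v \<in> V"
    then have "g (R v) \<in> U" using gRV by blast
    then show "gbar v \<in> Kbar \<longleftrightarrow> R v \<in> F"
      using inj_on_image_mem_iff[OF \<open>inj_on S U\<close>, of "g (R v)" "K \<inter> U"]
      by (simp add: gbar_eq Kbar_eq F_eq)
  qed
  have equiv: "local_minimizer f F p \<longleftrightarrow> local_minimizer fbar {v \<in> V. gbar v \<in> Kbar} 0"
    unfolding feasible fbar_eq by (rule local_minimizer_pullback[OF \<A> R])

  have "g p \<in> K" using \<open>p \<in> F\<close> F_eq by simp
  then obtain d l A where adapted: "adapted_chart \<B> eN n k K (g p) d l A"
    and Ti: "Ti = {v \<in> tangent_space \<B> (g p). v d \<in> corner_cone eN n k l A}"
    unfolding Ti_def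
    by (rule inner_tangent_cone_adapted[OF \<open>submanifold_with_corners \<B> eN n k K\<close>])
  have d: "d \<in> charts_at \<B> (g p)" and surj: "surjective_matrix eN n k l A"
    using adapted unfolding adapted_chart_def by auto
  obtain \<delta> where \<delta>: "\<delta> > 0"
    "\<And>w. w \<in> tangent_space \<B> (g p) \<Longrightarrow> norm (w d) < \<delta> \<Longrightarrow> w \<in> S ` U"
    using linearizing_map_covers_neighbourhood[OF \<B> S d] by blast
  have Kbar: "Kbar = S ` U \<inter> Ti" using SK by (simp add: Kbar_eq Int_commute)
  have cone: "tangent_cone_0 (tangent_space \<B> (g p)) Kbar = Ti"
    unfolding Kbar by (rule tangent_cone_conic_germ[OF \<B> d \<delta> Ti])

  \<comment> \<open>Coordinate representatives of the pulled-back problem\<close>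
  define c where "c = some_chart \<A> p"
  have c: "c \<in> charts_at \<A> p" unfolding c_def by (rule some_chart_in[OF \<A>])
  define T where "T = tangent_vec \<A> p c"
  define D where "D = frechet_derivative (snd d \<circ> g \<circ> chart_inv c) (at (snd c p))"
  define G where "G x = S (g (R (T x))) d" for x
  define h where "h x = f (R (T x))" for x
  have deriv: "tangent_map_deriv \<A> p \<B> (g p) gbar v d = D (v c)" for v
    unfolding gbar_eq tangent_map_deriv_eq[OF \<A> \<B> g R S gRV] D_def c_def
    by (rule map_deriv_chart[OF \<A> \<B> g d])
  have G: "(G has_derivative D) (at 0)"
    unfolding G_def[abs_def] D_def T_def by (rule linearized_map_C1(2)[OF \<A> \<B> g R S gRV c d])
  obtain X where X: "open X" "0 \<in> X" "T ` X \<subseteq> V" "C1_on X G"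
    using linearized_map_C1(1)[OF \<A> \<B> g R S gRV c d] unfolding G_def[abs_def] T_def by blast
  have h: "(h has_derivative frechet_derivative h (at 0)) (at 0)"
    unfolding h_def[abs_def] T_def by (rule pullback_fun_has_derivative[OF \<A> f R c])
  have R0: "R 0 = p" using R unfolding local_retraction_def by auto
  have T0: "T 0 = 0" unfolding T_def by (rule tangent_vec_0[OF \<A> c])
  have G0: "G 0 = 0" by (simp add: G_def T0 R0 ST)

  \<comment> \<open>The multiplier\<close>
  have kkt: "\<exists>\<mu>\<in>cotangent_space \<B> (g p).
        (\<forall>v\<in>tangent_space \<A> p.
           tangent_fun_deriv \<A> p fbar v + \<mu> (tangent_map_deriv \<A> p \<B> (g p) gbar v) = 0) \<and>
        \<mu> \<in> polar_cone \<B> (g p) Ti"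
    if min: "local_minimizer f F p"
      and zkrcq: "{a - b | a b. a \<in> map_deriv \<A> \<B> g p ` tangent_space \<A> p \<and> b \<in> Ti} =
        tangent_space \<B> (g p)"
  proof -
    obtain W where W: "open W" "0 \<in> W"
      "\<And>v. v \<in> V \<Longrightarrow> gbar v \<in> Kbar \<Longrightarrow> v \<in> W \<Longrightarrow> fbar 0 \<le> fbar v"
      using min[unfolded equiv] unfolding local_minimizer_def by blast
    define Y where "Y = X \<inter> T -` W"
    have Y: "open Y" "0 \<in> Y" "C1_on Y G"
    proof -
      show "open Y"
        unfolding Y_def T_def
        by (intro open_Int X(1) open_vimage[OF W(1) continuous_on_tangent_vec[OF \<A> c]])
      show "0 \<in> Y" using X(2) W(2) T0 by (simp add: Y_def)
      show "C1_on Y G" using X(4) by (rule C1_on_subset) (simp add: Y_def)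
    qed
    have "continuous_on Y G"
      using Y(3) unfolding C1_on_def
      by (meson continuous_at_imp_continuous_on has_derivative_continuous)
    \<comment> \<open>On this set \<open>gbar (T x)\<close> is short enough in chart
      \<open>d\<close> for \<open>\<delta>\<close> to place it in the image of \<open>S\<close>;
      with \<open>G x\<close> in the cone it then lies in \<open>Kbar\<close>.\<close>
    then have "open (Y \<inter> G -` ball 0 \<delta>)"
      using continuous_on_open_vimage[OF Y(1)] by (metis Int_commute open_ball)
    moreover have "0 \<in> Y \<inter> G -` ball 0 \<delta>" using Y(2) G0 \<delta>(1) by simp
    moreover have "C1_on (Y \<inter> G -` ball 0 \<delta>) G" using Y(3) by (rule C1_on_subset) blast
    moreover have "h 0 \<le> h x"
      if x: "x \<in> Y \<inter> G -` ball 0 \<delta>" "G x \<in> corner_cone eN n k l A" for x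
    proof -
      have TV: "T x \<in> V" "T x \<in> W" using x(1) X(3) by (auto simp: Y_def)
      then have gb: "gbar (T x) \<in> tangent_space \<B> (g p)" "gbar (T x) d = G x"
        using gRV ST(1) by (auto simp: gbar_eq G_def)
      then have "gbar (T x) \<in> Kbar"
        using x \<delta>(2) by (simp add: Kbar Ti)
      from W(3)[OF TV(1) this TV(2)] show ?thesis
        by (simp add: fbar_eq h_def T0)
    qed
    \<comment> \<open>ZKRCQ decomposes the tangent vector represented by \<open>w\<close>;
      evaluation in the chart \<open>d\<close> gives the coordinate form.\<close>
    moreover have "\<exists>u. \<exists>y\<in>corner_cone eN n k l A. w = D u - y" for w
    proof -
      have "tangent_vec \<B> (g p) d w \<in> {a - b | a b. a \<in> map_deriv \<A> \<B> g p ` tangent_space \<A> p \<and> b \<in> Ti}"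
        unfolding zkrcq by (rule tangent_vec_in[OF \<B> d])
      then obtain v b where "b \<in> Ti" "tangent_vec \<B> (g p) d w = map_deriv \<A> \<B> g p v - b"
        by blast
      then have "w = D (v c) - b d" "b d \<in> corner_cone eN n k l A"
        using map_deriv_chart[OF \<A> \<B> g d, of v] tangent_vec_apply[OF \<B> d, of w]
        by (simp_all add: Ti D_def c_def)
      then show ?thesis by blast
    qed
    ultimately obtain \<mu>0 where \<mu>0: "\<And>u. frechet_derivative h (at 0) u + \<mu>0 \<bullet> D u = 0"
      "\<And>y. y \<in> corner_cone eN n k l A \<Longrightarrow> \<mu>0 \<bullet> y \<le> 0"
      using kkt_corner_cone[OF \<open>coordinate_basis n eN\<close> surj _ _ _ G G0 h] by metis
    \<comment> \<open>The covector whose representative in the adapted chart is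
      \<open>\<mu>0\<close>.\<close>
    have \<mu>: "(\<lambda>w. \<mu>0 \<bullet> w d) \<in> cotangent_space \<B> (g p)"
      unfolding cotangent_space_def by (simp add: scaleR_fun_def inner_add_right)
    have "tangent_fun_deriv \<A> p fbar v = frechet_derivative h (at 0) (v c)" for v
      unfolding tangent_fun_deriv_def fbar_eq h_def[abs_def] T_def c_def
      by (simp add: Let_def comp_def)
    then show ?thesis
      using \<mu> \<mu>0 by (intro bexI[OF _ \<mu>]) (simp add: polar_cone_def Ti deriv)
  qed
  show ?thesis
    using equiv kkt unfolding cone Ti_def[symmetric] by blast
qed

end
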